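(* There is an algorithm that, given any instance $(G,\pi,S)$ of the problem Balanced Vertex where $G$ is a graph with $n$ vertices and $m$ edges, solves it in ${\cal O}(nm)$ time.
   Context: All graphs are finite, simple, connected, with unit-length edges; $n=|V|$, $m=|E|$, and $d(u,v)$ is the shortest-path distance. A proper vertex list is a list $S=(s_1,\ldots,s_p)$ of pairwise different vertices; $d(v,S)=\min_i d(v,s_i)$. The (prioritized) Voronoi diagram of $G=(V,E)$ with respect to $S$ is the partition of $V$ into territories $\mathbb{T}(s_1,S),\ldots,\mathbb{T}(s_p,S)$ where $v\in\mathbb{T}(s_i,S)$ if and only if $d(v,s_i)=d(v,S)$ and $d(v,s_j)>d(v,S)$ for every $j$ with $1\le j<i$. For a cost function $\pi:V\to\mathbb{R}_{\ge 0}$, the load of $s_i$ is $\ell_\pi(s_i,S)=\sum_{v\in\mathbb{T}(s_i,S)}\pi(v)$, and $L_\pi(S)=\max_i \ell_\pi(s_i,S)$. For $v\in V\setminus S$, $S+v=(s_1,\ldots,s_p,v)$. Balanced Vertex: given a graph $G=(V,E)$, a cost function $\pi:V\to\mathbb{R}_{\ge 0}$ and a proper vertex list $S$, output a vertex $v\in V\setminus S$ such that $L_\pi(S+v)$ is minimized. Running times are worst-case, in the usual unit-cost RAM model. *)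

theory Defs
  imports Complex_Main
begin

section \<open>Finite simple connected graphs\<close>

text \<open>A graph is a vertex set \<open>V\<close> together with a set \<open>E\<close> of two-element subsets of \<open>V\<close>.\<close>

definition simple_graph :: "'a set \<Rightarrow> 'a set set \<Rightarrow> bool" where
  "simple_graph V E \<longleftrightarrow>
     finite V \<and> (\<forall>e\<in>E. \<exists>u\<in>V. \<exists>v\<in>V. u \<noteq> v \<and> e = {u, v})"

definition is_path :: "'a set \<Rightarrow> 'a set set \<Rightarrow> 'a \<Rightarrow> 'a list \<Rightarrow> 'a \<Rightarrow> bool" where
  "is_path V E u xs v \<longleftrightarrow>
     xs \<noteq> [] \<and> hd xs = u \<and> last xs = v \<and> set xs \<subseteq> V \<and> distinct xs \<and>
     successively (\<lambda>x y. {x, y} \<in> E) xs"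

definition connected_graph :: "'a set \<Rightarrow> 'a set set \<Rightarrow> bool" where
  "connected_graph V E \<longleftrightarrow> (\<forall>u\<in>V. \<forall>v\<in>V. \<exists>xs. is_path V E u xs v)"

text \<open>A path listing \<open>k + 1\<close> vertices has length \<open>k\<close>. The value is meaningful only
  if \<open>u\<close> and \<open>v\<close> are joined by a path, in particular for vertices of a connected graph.\<close>

definition gdist :: "'a set \<Rightarrow> 'a set set \<Rightarrow> 'a \<Rightarrow> 'a \<Rightarrow> nat" where
  "gdist V E u v = (LEAST k. \<exists>xs. is_path V E u xs v \<and> length xs = Suc k)"


section \<open>Prioritized Voronoi diagrams and the problem Balanced Vertex\<close>

text \<open>Lists are indexed from 0 here, so \<open>s\<^sub>i\<close> is \<open>S ! (i - 1)\<close>. The functions \<open>gdist_list\<close>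
  and \<open>max_load\<close> are meaningful for nonempty \<open>S\<close>; the problem only evaluates them
  at lists of the form \<open>S @ [v]\<close>.\<close>

definition proper_vertex_list :: "'a set \<Rightarrow> 'a list \<Rightarrow> bool" where
  "proper_vertex_list V S \<longleftrightarrow> distinct S \<and> set S \<subseteq> V"

definition gdist_list :: "'a set \<Rightarrow> 'a set set \<Rightarrow> 'a \<Rightarrow> 'a list \<Rightarrow> nat" where
  "gdist_list V E v S = Min ((\<lambda>s. gdist V E v s) ` set S)"

definition territory :: "'a set \<Rightarrow> 'a set set \<Rightarrow> 'a list \<Rightarrow> nat \<Rightarrow> 'a set" where
  "territory V E S i =
     {v \<in> V. gdist V E v (S ! i) = gdist_list V E v S \<and>
             (\<forall>j<i. gdist V E v (S ! j) > gdist_list V E v S)}"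

definition territory_load ::
  "'a set \<Rightarrow> 'a set set \<Rightarrow> ('a \<Rightarrow> real) \<Rightarrow> 'a list \<Rightarrow> nat \<Rightarrow> real" where
  "territory_load V E \<pi> S i = (\<Sum>v\<in>territory V E S i. \<pi> v)"

definition max_load :: "'a set \<Rightarrow> 'a set set \<Rightarrow> ('a \<Rightarrow> real) \<Rightarrow> 'a list \<Rightarrow> real" where
  "max_load V E \<pi> S = Max (territory_load V E \<pi> S ` {..<length S})"

text \<open>The last condition says that a vertex to be output exists at all.\<close>

definition balanced_vertex_instance ::
  "'a set \<Rightarrow> 'a set set \<Rightarrow> ('a \<Rightarrow> real) \<Rightarrow> 'a list \<Rightarrow> bool" where
  "balanced_vertex_instance V E \<pi> S \<longleftrightarrow>
     simple_graph V E \<and> connected_graph V E \<and> (\<forall>v\<in>V. \<pi> v \<ge> 0) \<and>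
     proper_vertex_list V S \<and> V - set S \<noteq> {}"

definition balanced_vertex_solution ::
  "'a set \<Rightarrow> 'a set set \<Rightarrow> ('a \<Rightarrow> real) \<Rightarrow> 'a list \<Rightarrow> 'a \<Rightarrow> bool" where
  "balanced_vertex_solution V E \<pi> S v \<longleftrightarrow>
     v \<in> V - set S \<and>
     (\<forall>u \<in> V - set S. max_load V E \<pi> (S @ [v]) \<le> max_load V E \<pi> (S @ [u]))"


section \<open>Unit-cost random access machines with real-valued cells\<close>

text \<open>
  The machine has natural-number registers and memory cells (vertices, distances, addresses)
  and real-valued registers and memory cells (costs). Registers are named literally in an
  instruction, memory is addressed through a natural-number register. A program is a finite
  instruction list, so it uses only finitely many registers, whereas the two memories
  are unbounded.

  The arithmetic is deliberately minimal: unit-cost multiplication of integers, rounding of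
  reals, and real constants other than 0 are absent, as those are the features that would
  make the unit-cost measure unrealistic. Subtraction of naturals is truncated at 0.
\<close>

datatype instr =
    Const nat nat            (* r := k *)
  | Move nat nat             (* r := s *)
  | Add nat nat nat          (* r := s + t *)
  | Sub nat nat nat          (* r := s - t *)
  | Load nat nat             (* r := mem[s] *)
  | Store nat nat            (* mem[r] := s *)
  | RZero nat                (* x := 0 *)
  | RMove nat nat            (* x := y *)
  | RAdd nat nat nat         (* x := y + z *)
  | RSub nat nat nat         (* x := y - z *)
  | RLoad nat nat            (* x := rmem[s] *)
  | RStore nat nat           (* rmem[r] := y *)
  | Jump nat                 (* goto l *)
  | JumpLess nat nat nat     (* if r < s then goto l *)
  | JumpEq nat nat nat       (* if r = s then goto l *)
  | RJumpLess nat nat nat    (* if x < y then goto l *)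

type_synonym program = "instr list"

record config =
  pc :: nat
  reg :: "nat \<Rightarrow> nat"
  mem :: "nat \<Rightarrow> nat"
  rreg :: "nat \<Rightarrow> real"
  rmem :: "nat \<Rightarrow> real"

text \<open>\<open>exec i c\<close> is the effect of \<open>i\<close> on \<open>c\<close>, where the program counter of \<open>c\<close> has
  already been advanced to the instruction after \<open>i\<close>.\<close>

fun exec :: "instr \<Rightarrow> config \<Rightarrow> config" where
  "exec (Const r k) c = c\<lparr>reg := (reg c)(r := k)\<rparr>"
| "exec (Move r s) c = c\<lparr>reg := (reg c)(r := reg c s)\<rparr>"
| "exec (Add r s t) c = c\<lparr>reg := (reg c)(r := reg c s + reg c t)\<rparr>"
| "exec (Sub r s t) c = c\<lparr>reg := (reg c)(r := reg c s - reg c t)\<rparr>"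
| "exec (Load r s) c = c\<lparr>reg := (reg c)(r := mem c (reg c s))\<rparr>"
| "exec (Store r s) c = c\<lparr>mem := (mem c)(reg c r := reg c s)\<rparr>"
| "exec (RZero x) c = c\<lparr>rreg := (rreg c)(x := 0)\<rparr>"
| "exec (RMove x y) c = c\<lparr>rreg := (rreg c)(x := rreg c y)\<rparr>"
| "exec (RAdd x y z) c = c\<lparr>rreg := (rreg c)(x := rreg c y + rreg c z)\<rparr>"
| "exec (RSub x y z) c = c\<lparr>rreg := (rreg c)(x := rreg c y - rreg c z)\<rparr>"
| "exec (RLoad x s) c = c\<lparr>rreg := (rreg c)(x := rmem c (reg c s))\<rparr>"
| "exec (RStore r y) c = c\<lparr>rmem := (rmem c)(reg c r := rreg c y)\<rparr>"
| "exec (Jump l) c = c\<lparr>pc := l\<rparr>"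
| "exec (JumpLess r s l) c = (if reg c r < reg c s then c\<lparr>pc := l\<rparr> else c)"
| "exec (JumpEq r s l) c = (if reg c r = reg c s then c\<lparr>pc := l\<rparr> else c)"
| "exec (RJumpLess x y l) c = (if rreg c x < rreg c y then c\<lparr>pc := l\<rparr> else c)"

text \<open>The machine halts when control leaves the program; a halted configuration is kept.\<close>

definition halted :: "program \<Rightarrow> config \<Rightarrow> bool" where
  "halted P c \<longleftrightarrow> length P \<le> pc c"

definition step :: "program \<Rightarrow> config \<Rightarrow> config" where
  "step P c = (if halted P c then c else exec (P ! pc c) (c\<lparr>pc := Suc (pc c)\<rparr>))"

definition run :: "program \<Rightarrow> nat \<Rightarrow> config \<Rightarrow> config" where
  "run P t c = (step P ^^ t) c"

text \<open>\<open>P\<close>, started in \<open>c\<close>, halts after at most \<open>t\<close> unit-cost steps in \<open>c'\<close>.\<close>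

definition halts_within :: "program \<Rightarrow> config \<Rightarrow> nat \<Rightarrow> config \<Rightarrow> bool" where
  "halts_within P c t c' \<longleftrightarrow> run P t c = c' \<and> halted P c'"


section \<open>Input and output\<close>

text \<open>The vertices of an input graph are numbered \<open>0, \<dots>, n - 1\<close>. The graph is given by
  adjacency lists, whose internal order is arbitrary.\<close>

definition adjacency_lists :: "nat \<Rightarrow> nat set set \<Rightarrow> (nat \<Rightarrow> nat list) \<Rightarrow> bool" where
  "adjacency_lists n E adj \<longleftrightarrow>
     (\<forall>v<n. distinct (adj v) \<and> set (adj v) = {u. {v, u} \<in> E})"

text \<open>The memory holds \<open>n\<close>, the list \<open>S\<close> and the \<open>n\<close> adjacency lists, each list
  preceded by its length, consecutively from address 0; the real memory holds the costs of
  the vertices. All other cells and all registers are initially 0.\<close>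

definition encode_input :: "nat \<Rightarrow> (nat \<Rightarrow> nat list) \<Rightarrow> nat list \<Rightarrow> nat list" where
  "encode_input n adj S =
     n # length S # S @ concat (map (\<lambda>v. length (adj v) # adj v) [0..<n])"

definition initial_config ::
  "nat \<Rightarrow> (nat \<Rightarrow> nat list) \<Rightarrow> (nat \<Rightarrow> real) \<Rightarrow> nat list \<Rightarrow> config" where
  "initial_config n adj \<pi> S =
     \<lparr>pc = 0,
      reg = (\<lambda>_. 0),
      mem = (\<lambda>a. if a < length (encode_input n adj S) then encode_input n adj S ! a else 0),
      rreg = (\<lambda>_. 0),
      rmem = (\<lambda>a. if a < n then \<pi> a else 0)\<rparr>"

definition result_of :: "config \<Rightarrow> nat" where
  "result_of c = reg c 0"

end

theory Submission
  imports Defs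
begin

text \<open>
  Breadth-first search from every vertex yields the full distance matrix in \<open>O(n (n + m))\<close> steps,
  which is \<open>O(n m)\<close> for a connected graph with at least one edge. One scan of \<open>S\<close> per vertex \<open>u\<close>
  then gives the index of the territory of \<open>u\<close> with respect to \<open>S\<close> and the distance of \<open>u\<close> to
  \<open>S\<close>. The new vertex has the lowest priority in \<open>S + v\<close>, so it takes over exactly those \<open>u\<close> with
  \<open>d(u, v) < d(u, S)\<close>; hence all loads for one candidate \<open>v\<close>, and their maximum, are computed
  in \<open>O(n)\<close> steps.
\<close>

section \<open>Distances and degrees\<close>

text \<open>The passage from \<open>n (n + m)\<close> to \<open>n m\<close> rests on
  \<open>n \<le> 2 m\<close>: in a connected graph with an edge each vertex has degree at least one,
  so the degree sum \<open>2 m\<close> is at least \<open>n\<close>. Without edges, a connected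
  graph with an eligible vertex is a single vertex, and \<open>n m = 0\<close> does not bound the
  steps that this program takes; hence the restriction to \<open>card E > 0\<close>. Jumps are
  treated once and for all in proof rules for a small structured language, where step counts add up
  along the syntax. Only breadth-first search needs amortisation, because one of its rounds costs as
  much as the degree of the vertex it finishes; every other loop has a uniform bound per round. The
  poor instruction set shapes the data. Rows of the distance matrix are reached by repeatedly adding
  \<open>n\<close>, as there is no multiplication. Distances are stored plus one, so that fresh
  memory means unvisited. Maxima of loads start from 0, the only real constant, and a flag stands in
  for an infinite initial optimum.\<close>

lemma gdist_le:
  assumes "is_path V E u xs v"
  shows "gdist V E u v \<le> length xs - 1"
proof -
  have "length xs = Suc (length xs - 1)"
    using assms by (simp add: is_path_def)
  then show ?thesis
    unfolding gdist_def using assms by (intro Least_le) blast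
qed

lemma gdist_path:
  assumes "connected_graph V E" "u \<in> V" "v \<in> V"
  obtains xs where "is_path V E u xs v" "length xs = Suc (gdist V E u v)"
proof -
  obtain xs where xs: "is_path V E u xs v"
    using assms unfolding connected_graph_def by blast
  then have "length xs = Suc (length xs - 1)"
    by (simp add: is_path_def)
  then have "\<exists>xs. is_path V E u xs v \<and> length xs = Suc (gdist V E u v)"
    unfolding gdist_def using xs
    by (intro LeastI[of "\<lambda>k. \<exists>xs. is_path V E u xs v \<and> length xs = Suc k"]) blast
  then show thesis
    using that by blast
qed

lemma gdist_self:
  assumes "u \<in> V"
  shows "gdist V E u u = 0"
  using gdist_le[of V E u "[u]" u] assms by (simp add: is_path_def)

lemma gdist_eq_0_iff:
  assumes "connected_graph V E" "u \<in> V" "v \<in> V"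
  shows "gdist V E u v = 0 \<longleftrightarrow> u = v"
proof
  assume "gdist V E u v = 0"
  then obtain xs where "is_path V E u xs v" "length xs = 1"
    using gdist_path[OF assms] by auto
  then show "u = v"
    by (auto simp: is_path_def length_Suc_conv)
qed (use assms gdist_self in auto)

lemma gdist_less_card:
  assumes "connected_graph V E" "finite V" "u \<in> V" "v \<in> V"
  shows "gdist V E u v < card V"
proof -
  obtain xs where xs: "is_path V E u xs v" "length xs = Suc (gdist V E u v)"
    using gdist_path[OF assms(1,3,4)] .
  then have "length xs = card (set xs)"
    by (simp add: is_path_def distinct_card)
  also have "\<dots> \<le> card V"
    using xs assms(2) by (intro card_mono) (auto simp: is_path_def)
  finally show ?thesis
    using xs by simp
qed

text \<open>Paths are simple, so \<open>y\<close> can be appended to a shortest path to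
  \<open>x\<close> only if it is not yet on it. Otherwise the path cut at \<open>y\<close> is
  already short enough.\<close>

lemma gdist_step:
  assumes "connected_graph V E" "u \<in> V" "x \<in> V" "y \<in> V" "{x, y} \<in> E"
  shows "gdist V E u y \<le> Suc (gdist V E u x)"
proof -
  obtain xs where xs: "is_path V E u xs x" "length xs = Suc (gdist V E u x)"
    using gdist_path[OF assms(1,2,3)] .
  show ?thesis
  proof (cases "y \<in> set xs")
    case True
    then obtain ys zs where split: "xs = ys @ y # zs"
      by (meson split_list)
    then have "is_path V E u (ys @ [y]) y"
      using xs(1) by (auto simp: is_path_def successively_append_iff hd_append split: if_splits)
    from gdist_le[OF this] show ?thesis
      using xs(2) split by simp
  next
    case False
    then have "is_path V E u (xs @ [y]) y"
      using xs(1) assms by (auto simp: is_path_def successively_append_iff)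
    from gdist_le[OF this] show ?thesis
      using xs(2) by simp
  qed
qed

text \<open>Take the last but one vertex of a shortest path: the path without its end bounds its
  distance from above, \<open>gdist_step\<close> from below.\<close>

lemma gdist_predecessor:
  assumes "connected_graph V E" "u \<in> V" "v \<in> V" "u \<noteq> v"
  obtains x where "x \<in> V" "{x, v} \<in> E" "Suc (gdist V E u x) = gdist V E u v"
proof -
  obtain xs where xs: "is_path V E u xs v" "length xs = Suc (gdist V E u v)"
    using gdist_path[OF assms(1,2,3)] .
  have ne: "gdist V E u v \<noteq> 0"
    using gdist_eq_0_iff[OF assms(1,2,3)] assms(4) by simp
  define ys where "ys = butlast xs"
  have split: "xs = ys @ [v]"
    using xs(1) append_butlast_last_id[of xs] by (simp add: ys_def is_path_def)
  have "ys \<noteq> []"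
    using split xs(2) ne by auto
  then have path: "is_path V E u ys (last ys)" and edge: "{last ys, v} \<in> E" and V: "last ys \<in> V"
    using xs(1) last_in_set[of ys] unfolding split by (auto simp: is_path_def successively_append_iff)
  have "gdist V E u (last ys) \<le> gdist V E u v - 1"
    using gdist_le[OF path] xs(2) split by simp
  moreover have "gdist V E u v \<le> Suc (gdist V E u (last ys))"
    using gdist_step[OF assms(1,2) V assms(3) edge] .
  ultimately show thesis
    using that V edge ne by simp
qed

section \<open>Degree sum and number of vertices\<close>

lemma simple_graph_edge:
  assumes "simple_graph V E" "{a, b} \<in> E"
  shows "a \<in> V" "b \<in> V"
  using assms by (auto simp: simple_graph_def doubleton_eq_iff)

text \<open>Handshake lemma: ordered pairs are counted by their first vertex and by their underlying
  edge, which has two orientations because its ends differ.\<close>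

lemma sum_degrees:
  assumes "simple_graph V E"
  shows "(\<Sum>v\<in>V. card {u. {v, u} \<in> E}) = 2 * card E"
proof -
  let ?arcs = "SIGMA v:V. {u. {v, u} \<in> E}"
  have sub: "{u. {v, u} \<in> E} \<subseteq> V" for v
    using simple_graph_edge(2)[OF assms] by blast
  have fin: "finite V" "finite {u. {v, u} \<in> E}" for v
    using assms finite_subset[OF sub] by (auto simp: simple_graph_def)
  have "E \<subseteq> Pow V"
    using assms by (auto simp: simple_graph_def)
  then have finE: "finite E"
    using fin(1) finite_subset by blast
  have "(\<Sum>v\<in>V. card {u. {v, u} \<in> E}) = card ?arcs"
    using fin by simp
  also have "?arcs = (\<Union>e\<in>E. {(v, u). {v, u} = e})"
    using simple_graph_edge(1)[OF assms] by auto
  also have "card \<dots> = (\<Sum>e\<in>E. card {(v, u). {v, u} = e})"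
  proof (rule card_UN_disjoint)
    show "\<forall>e\<in>E. finite {(v, u). {v, u} = e}"
    proof
      fix e assume "e \<in> E"
      then obtain a b where "e = {a, b}"
        using assms by (auto simp: simple_graph_def)
      then have "{(v, u). {v, u} = e} \<subseteq> {a, b} \<times> {a, b}"
        by auto
      then show "finite {(v, u). {v, u} = e}"
        by (rule finite_subset) auto
    qed
  qed (use finE in auto)
  also have "\<dots> = (\<Sum>e\<in>E. 2)"
  proof (rule sum.cong[OF refl])
    fix e assume "e \<in> E"
    then obtain a b where ab: "e = {a, b}" "a \<noteq> b"
      using assms by (auto simp: simple_graph_def)
    then have "{(v, u). {v, u} = e} = {(a, b), (b, a)}"
      by (auto simp: doubleton_eq_iff)
    then show "card {(v, u). {v, u} = e} = 2"
      using ab by simp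
  qed
  finally show ?thesis
    by simp
qed

text \<open>An edge provides two vertices, so each \<open>v\<close> has a neighbour, namely its
  predecessor on a shortest path from some other vertex. The degree sum then gives a bound that is
  weaker than \<open>card E + 1\<close> but costs only a constant factor.\<close>

lemma card_vertices_le:
  assumes "simple_graph V E" "connected_graph V E" "E \<noteq> {}"
  shows "card V \<le> 2 * card E"
proof -
  have sub: "{u. {v, u} \<in> E} \<subseteq> V" for v
    using simple_graph_edge(2)[OF assms(1)] by blast
  have fin: "finite V"
    using assms(1) by (simp add: simple_graph_def)
  obtain a b where ab: "a \<in> V" "b \<in> V" "a \<noteq> b"
    using assms(1,3) by (fastforce simp: simple_graph_def)
  have "card {u. {v, u} \<in> E} \<ge> 1" if "v \<in> V" for v
  proof -
    obtain w where "w \<in> V" "w \<noteq> v"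
      using ab by metis
    then obtain x where "{x, v} \<in> E"
      using gdist_predecessor[OF assms(2) _ \<open>v \<in> V\<close>] by blast
    then have "x \<in> {u. {v, u} \<in> E}"
      by (simp add: insert_commute)
    then have "0 < card {u. {v, u} \<in> E}"
      using finite_subset[OF sub fin] card_gt_0_iff by blast
    then show ?thesis
      by simp
  qed
  then have "(\<Sum>v\<in>V. 1) \<le> (\<Sum>v\<in>V. card {u. {v, u} \<in> E})"
    by (intro sum_mono) simp
  then show ?thesis
    using sum_degrees[OF assms(1)] by simp
qed

section \<open>Structured programs\<close>

datatype test = Less nat nat | RLess nat nat

datatype com =
    Block "instr list"
  | Seq com com (infixr \<open>;;\<close> 60)
  | Cond test com com
  | While test com

fun holds :: "test \<Rightarrow> config \<Rightarrow> bool" where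
  "holds (Less r s) c \<longleftrightarrow> reg c r < reg c s"
| "holds (RLess x y) c \<longleftrightarrow> rreg c x < rreg c y"

fun jump_if :: "test \<Rightarrow> nat \<Rightarrow> instr" where
  "jump_if (Less r s) l = JumpLess r s l"
| "jump_if (RLess x y) l = RJumpLess x y l"

fun is_jump :: "instr \<Rightarrow> bool" where
  "is_jump (Jump _) \<longleftrightarrow> True"
| "is_jump (JumpLess _ _ _) \<longleftrightarrow> True"
| "is_jump (JumpEq _ _ _) \<longleftrightarrow> True"
| "is_jump (RJumpLess _ _ _) \<longleftrightarrow> True"
| "is_jump _ \<longleftrightarrow> False"

text \<open>Jump targets are absolute, so the code depends on its start address while its length
  does not; hence targets can be computed before the code is placed.\<close>

fun code_length :: "com \<Rightarrow> nat" where
  "code_length (Block is) = length is"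
| "code_length (a ;; b) = code_length a + code_length b"
| "code_length (Cond b c d) = 3 + code_length c + code_length d"
| "code_length (While b c) = 3 + code_length c"

text \<open>The test jumps over the jump at \<open>l + 1\<close>, which leads to the alternative or
  out of the loop. With the jump that closes the first branch or the loop body this makes three
  extra instructions, of which exactly two are executed on either way.\<close>

fun compile :: "nat \<Rightarrow> com \<Rightarrow> program" where
  "compile l (Block is) = is"
| "compile l (a ;; b) = compile l a @ compile (l + code_length a) b"
| "compile l (Cond b c d) =
     jump_if b (l + 2) # Jump (l + 3 + code_length c) # compile (l + 2) c @
     Jump (l + 3 + code_length c + code_length d) # compile (l + 3 + code_length c) d"
| "compile l (While b c) =
     jump_if b (l + 2) # Jump (l + 3 + code_length c) # compile (l + 2) c @ [Jump l]"

lemma length_compile [simp]: "length (compile l c) = code_length c"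
  by (induction c arbitrary: l) auto

definition code_at :: "program \<Rightarrow> nat \<Rightarrow> program \<Rightarrow> bool" where
  "code_at P l is \<longleftrightarrow> (\<exists>A B. P = A @ is @ B \<and> length A = l)"

lemma code_at_append:
  assumes "code_at P l (xs @ ys)"
  shows "code_at P l xs" "code_at P (l + length xs) ys"
proof -
  obtain A B where AB: "P = A @ (xs @ ys) @ B" "length A = l"
    using assms by (auto simp: code_at_def)
  then show "code_at P l xs"
    by (auto simp: code_at_def)
  have "P = (A @ xs) @ ys @ B" "length (A @ xs) = l + length xs"
    using AB by auto
  then show "code_at P (l + length xs) ys"
    unfolding code_at_def by blast
qed

lemma code_at_Cons:
  assumes "code_at P l (i # is)"
  shows "l < length P" "P ! l = i" "code_at P (Suc l) is"
proof -
  have 1: "code_at P l [i]" and 2: "code_at P (l + 1) is"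
    using code_at_append[of P l "[i]" "is"] assms by simp_all
  obtain A B where "P = A @ i # B" "length A = l"
    using 1 unfolding code_at_def by auto
  then show "l < length P" "P ! l = i"
    by auto
  show "code_at P (Suc l) is"
    using 2 by simp
qed

section \<open>Execution of compiled code and timed proof rules\<close>

lemma run_0: "run P 0 c = c"
  by (simp add: run_def)

lemma run_Suc: "run P (Suc t) c = run P t (step P c)"
  by (simp add: run_def funpow_swap1)

lemma run_add: "run P (t + t') c = run P t' (run P t c)"
  by (simp add: run_def funpow_add add.commute[of t])

lemma step_code_at:
  "code_at P l (i # is) \<Longrightarrow> step P (s\<lparr>pc := l\<rparr>) = exec i (s\<lparr>pc := Suc l\<rparr>)"
  using code_at_Cons[of P l i "is"] by (simp add: step_def halted_def)

lemma exec_pc: "\<not> is_jump i \<Longrightarrow> exec i (s\<lparr>pc := l\<rparr>) = (exec i s)\<lparr>pc := l\<rparr>"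
  by (cases i) auto

lemma exec_jump_if:
  "exec (jump_if b l) (s\<lparr>pc := l'\<rparr>) = s\<lparr>pc := (if holds b s then l else l')\<rparr>"
  by (cases b) auto

text \<open>The program counter of the final state is left unspecified, so that \<open>Q\<close> may speak about
  registers and memory only.\<close>

definition achieves :: "com \<Rightarrow> config \<Rightarrow> nat \<Rightarrow> (config \<Rightarrow> bool) \<Rightarrow> bool" where
  "achieves c s T Q \<longleftrightarrow>
     (\<forall>P l. code_at P l (compile l c) \<longrightarrow>
        (\<exists>t\<le>T. \<exists>s'. run P t (s\<lparr>pc := l\<rparr>) = s'\<lparr>pc := l + code_length c\<rparr> \<and> Q s'))"

lemma achievesI:
  assumes "\<And>P l. code_at P l (compile l c) \<Longrightarrow>
    \<exists>t\<le>T. \<exists>s'. run P t (s\<lparr>pc := l\<rparr>) = s'\<lparr>pc := l + code_length c\<rparr> \<and> Q s'"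
  shows "achieves c s T Q"
  using assms by (simp add: achieves_def)

lemma achievesE:
  assumes "achieves c s T Q" "code_at P l (compile l c)"
  obtains t s' where "t \<le> T" "run P t (s\<lparr>pc := l\<rparr>) = s'\<lparr>pc := l + code_length c\<rparr>" "Q s'"
  using assms unfolding achieves_def by blast

lemma achieves_weaken:
  assumes "achieves c s T Q" "T \<le> T'" "\<And>s'. Q s' \<Longrightarrow> Q' s'"
  shows "achieves c s T' Q'"
  using assms unfolding achieves_def by (meson order_trans)

lemma run_block:
  assumes "code_at P l is" "\<forall>i\<in>set is. \<not> is_jump i"
  shows "run P (length is) (s\<lparr>pc := l\<rparr>) = (fold exec is s)\<lparr>pc := l + length is\<rparr>"
  using assms
proof (induction "is" arbitrary: l s)
  case Nil
  then show ?case by (simp add: run_0)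
next
  case (Cons i "is")
  then have "step P (s\<lparr>pc := l\<rparr>) = (exec i s)\<lparr>pc := Suc l\<rparr>"
    by (simp add: step_code_at exec_pc)
  then show ?case
    using Cons.IH[of "Suc l" "exec i s"] Cons.prems code_at_Cons(3)[of P l i "is"]
    by (simp add: run_Suc)
qed

lemma achieves_Block:
  assumes "\<forall>i\<in>set is. \<not> is_jump i" "length is \<le> T" "Q (fold exec is s)"
  shows "achieves (Block is) s T Q"
  using assms run_block by (intro achievesI) fastforce

lemma achieves_Seq:
  assumes "achieves a s T1 R" "\<And>s'. R s' \<Longrightarrow> achieves b s' T2 Q" "T1 + T2 \<le> T"
  shows "achieves (a ;; b) s T Q"
proof (rule achievesI)
  fix P l
  assume "code_at P l (compile l (a ;; b))"
  then have ca: "code_at P l (compile l a)"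
    and cb: "code_at P (l + code_length a) (compile (l + code_length a) b)"
    using code_at_append[of P l "compile l a"] by auto
  obtain t1 s1 where 1: "t1 \<le> T1" "R s1"
    "run P t1 (s\<lparr>pc := l\<rparr>) = s1\<lparr>pc := l + code_length a\<rparr>"
    using assms(1) ca by (rule achievesE)
  obtain t2 s2 where 2: "t2 \<le> T2" "Q s2"
    "run P t2 (s1\<lparr>pc := l + code_length a\<rparr>) = s2\<lparr>pc := l + code_length a + code_length b\<rparr>"
    using assms(2)[OF 1(2)] cb by (rule achievesE)
  show "\<exists>t\<le>T. \<exists>s'. run P t (s\<lparr>pc := l\<rparr>) = s'\<lparr>pc := l + code_length (a ;; b)\<rparr> \<and> Q s'"
    using 1 2 assms(3)
    by (intro exI[of _ "t1 + t2"] conjI exI[of _ s2]) (auto simp: run_add add.assoc)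
qed

lemma achieves_Cond:
  assumes "holds b s \<Longrightarrow> achieves c s T Q" "\<not> holds b s \<Longrightarrow> achieves d s T Q" "T + 2 \<le> T'"
  shows "achieves (Cond b c d) s T' Q"
proof (rule achievesI)
  fix P l
  let ?e = "l + code_length (Cond b c d)"
  assume code: "code_at P l (compile l (Cond b c d))"
  define rest where "rest = Jump (l + 3 + code_length c + code_length d) #
    compile (l + 3 + code_length c) d"
  have c1: "code_at P l (jump_if b (l + 2) # Jump (l + 3 + code_length c) #
      compile (l + 2) c @ rest)"
    using code by (simp add: rest_def)
  note c2 = code_at_Cons(3)[OF c1]
  have c3: "code_at P (l + 2) (compile (l + 2) c @ rest)"
    using code_at_Cons(3)[OF c2] by simp
  have cc: "code_at P (l + 2) (compile (l + 2) c)"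
    using code_at_append(1)[OF c3] .
  have cj: "code_at P (l + 2 + code_length c) rest"
    using code_at_append(2)[OF c3] by simp
  have cd: "code_at P (l + 3 + code_length c) (compile (l + 3 + code_length c) d)"
    using code_at_Cons(3)[OF cj[unfolded rest_def]] by (simp add: eval_nat_numeral)
  have s1: "step P (s\<lparr>pc := l\<rparr>) = s\<lparr>pc := (if holds b s then l + 2 else Suc l)\<rparr>"
    using step_code_at[OF c1] by (simp add: exec_jump_if)
  show "\<exists>t\<le>T'. \<exists>s'. run P t (s\<lparr>pc := l\<rparr>) = s'\<lparr>pc := ?e\<rparr> \<and> Q s'"
  proof (cases "holds b s")
    case True
    obtain t s' where t: "t \<le> T" "Q s'"
      "run P t (s\<lparr>pc := l + 2\<rparr>) = s'\<lparr>pc := l + 2 + code_length c\<rparr>"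
      using assms(1)[OF True] cc by (rule achievesE)
    have "step P (s'\<lparr>pc := l + 2 + code_length c\<rparr>) = s'\<lparr>pc := ?e\<rparr>"
      using step_code_at[OF cj[unfolded rest_def]] by (simp add: algebra_simps)
    then have "run P (Suc (t + Suc 0)) (s\<lparr>pc := l\<rparr>) = s'\<lparr>pc := ?e\<rparr>"
      unfolding run_Suc[of P "t + Suc 0"] s1 run_add using True t by (simp add: run_Suc run_0)
    then show ?thesis
      using t assms(3) by (intro exI[of _ "Suc (t + Suc 0)"]) auto
  next
    case False
    obtain t s' where t: "t \<le> T" "Q s'"
      "run P t (s\<lparr>pc := l + 3 + code_length c\<rparr>) = s'\<lparr>pc := l + 3 + code_length c + code_length d\<rparr>"
      using assms(2)[OF False] cd by (rule achievesE)
    have "step P (s\<lparr>pc := Suc l\<rparr>) = s\<lparr>pc := l + 3 + code_length c\<rparr>"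
      using step_code_at[OF c2] by simp
    then have "run P (Suc (Suc t)) (s\<lparr>pc := l\<rparr>) = s'\<lparr>pc := ?e\<rparr>"
      unfolding run_Suc s1 using False t by (simp add: algebra_simps)
    then show ?thesis
      using t assms(3) by (intro exI[of _ "Suc (Suc t)"]) auto
  qed
qed

text \<open>The time still available, \<open>\<phi>\<close>, serves both as amortised cost bound and as termination
  measure.\<close>

lemma achieves_While:
  assumes "I \<phi> s"
    and "\<And>\<phi> s. I \<phi> s \<Longrightarrow> holds b s \<Longrightarrow>
           \<exists>T. achieves c s T (\<lambda>s'. \<exists>\<phi>'. I \<phi>' s' \<and> \<phi>' + T + 2 \<le> \<phi>)"
    and "\<And>\<phi> s. I \<phi> s \<Longrightarrow> \<not> holds b s \<Longrightarrow> Q s"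
    and "\<phi> + 2 \<le> T'"
  shows "achieves (While b c) s T' Q"
proof (rule achievesI)
  fix P l
  let ?e = "l + code_length (While b c)"
  assume code: "code_at P l (compile l (While b c))"
  have c1: "code_at P l (jump_if b (l + 2) # Jump (l + 3 + code_length c) #
      compile (l + 2) c @ [Jump l])"
    using code by simp
  note c2 = code_at_Cons(3)[OF c1]
  have c3: "code_at P (l + 2) (compile (l + 2) c @ [Jump l])"
    using code_at_Cons(3)[OF c2] by simp
  have cc: "code_at P (l + 2) (compile (l + 2) c)"
    using code_at_append(1)[OF c3] .
  have cj: "code_at P (l + 2 + code_length c) [Jump l]"
    using code_at_append(2)[OF c3] by simp
  have s1: "step P (s\<lparr>pc := l\<rparr>) = s\<lparr>pc := (if holds b s then l + 2 else Suc l)\<rparr>" for s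
    using step_code_at[OF c1] by (simp add: exec_jump_if)
  \<comment> \<open>The two jumps of a round make \<open>\<phi>'\<close> strictly smaller than
    \<open>\<phi>\<close> even if \<open>T = 0\<close>, so well-founded induction applies. The final
    \<open>+ 2\<close> pays for the failing test and the jump out of the loop.\<close>
  have "\<exists>t\<le>\<phi> + 2. \<exists>s'. run P t (s\<lparr>pc := l\<rparr>) = s'\<lparr>pc := ?e\<rparr> \<and> Q s'"
    using assms(1)
  proof (induction \<phi> arbitrary: s rule: less_induct)
    case (less \<phi>)
    show ?case
    proof (cases "holds b s")
      case True
      obtain T where T: "achieves c s T (\<lambda>s'. \<exists>\<phi>'. I \<phi>' s' \<and> \<phi>' + T + 2 \<le> \<phi>)"
        using assms(2)[OF less.prems True] by blast
      obtain t s1 where t: "t \<le> T" "\<exists>\<phi>'. I \<phi>' s1 \<and> \<phi>' + T + 2 \<le> \<phi>"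
        "run P t (s\<lparr>pc := l + 2\<rparr>) = s1\<lparr>pc := l + 2 + code_length c\<rparr>"
        using T cc by (rule achievesE)
      obtain \<phi>' where \<phi>': "I \<phi>' s1" "\<phi>' + T + 2 \<le> \<phi>"
        using t(2) by blast
      obtain t' s' where t': "t' \<le> \<phi>' + 2" "run P t' (s1\<lparr>pc := l\<rparr>) = s'\<lparr>pc := ?e\<rparr>" "Q s'"
        using less.IH[of \<phi>' s1] \<phi>' by auto
      have "step P (s1\<lparr>pc := l + 2 + code_length c\<rparr>) = s1\<lparr>pc := l\<rparr>"
        using step_code_at[OF cj] by simp
      then have "run P (Suc (t + Suc t')) (s\<lparr>pc := l\<rparr>) = s'\<lparr>pc := ?e\<rparr>"
        unfolding run_Suc[of P "t + Suc t'"] s1 run_add using True t t' by (simp add: run_Suc)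
      then show ?thesis
        using t(1) t' \<phi>' by (intro exI[of _ "Suc (t + Suc t')"]) auto
    next
      case False
      have "step P (s\<lparr>pc := Suc l\<rparr>) = s\<lparr>pc := l + 3 + code_length c\<rparr>"
        using step_code_at[OF c2] by simp
      then have "run P (Suc (Suc 0)) (s\<lparr>pc := l\<rparr>) = s\<lparr>pc := ?e\<rparr>"
        unfolding run_Suc s1 using False by (simp add: run_0 algebra_simps)
      then show ?thesis
        using assms(3)[OF less.prems False] by (intro exI[of _ "Suc (Suc 0)"]) auto
    qed
  qed
  then show "\<exists>t\<le>T'. \<exists>s'. run P t (s\<lparr>pc := l\<rparr>) = s'\<lparr>pc := ?e\<rparr> \<and> Q s'"
    using assms(4) by (meson order_trans)
qed

text \<open>The potential is \<open>(N - j) * (T + 2)\<close>: each remaining round costs at most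
  \<open>T\<close> plus the two jumps.\<close>

lemma achieves_counting_While:
  assumes "I 0 s"
    and "\<And>j s. I j s \<Longrightarrow> j \<le> N \<Longrightarrow> holds b s \<longleftrightarrow> j < N"
    and "\<And>j s. I j s \<Longrightarrow> j < N \<Longrightarrow> achieves c s T (I (Suc j))"
    and "\<And>s. I N s \<Longrightarrow> Q s"
    and "N * (T + 2) + 2 \<le> T'"
  shows "achieves (While b c) s T' Q"
proof (rule achieves_While[where I = "\<lambda>\<phi> s. \<exists>j\<le>N. I j s \<and> \<phi> = (N - j) * (T + 2)"])
  show "\<exists>j\<le>N. I j s \<and> N * (T + 2) = (N - j) * (T + 2)"
    using assms(1) by auto
next
  fix \<phi> s
  assume "\<exists>j\<le>N. I j s \<and> \<phi> = (N - j) * (T + 2)" "holds b s"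
  then obtain j where "j \<le> N" and I: "I j s" and \<phi>: "\<phi> = (N - j) * (T + 2)" and "holds b s"
    by blast
  then have j: "j < N" "I j s" "\<phi> = (N - j) * (T + 2)"
    using assms(2)[OF I] by simp_all
  have "N - j = Suc (N - Suc j)"
    using j(1) by simp
  then have "(N - Suc j) * (T + 2) + T + 2 \<le> \<phi>"
    using j(3) by simp
  then have "\<exists>\<phi>'. (\<exists>j\<le>N. I j s' \<and> \<phi>' = (N - j) * (T + 2)) \<and> \<phi>' + T + 2 \<le> \<phi>" if "I (Suc j) s'" for s'
    using that j(1) Suc_leI by blast
  then have "achieves c s T (\<lambda>s'. \<exists>\<phi>'. (\<exists>j\<le>N. I j s' \<and> \<phi>' = (N - j) * (T + 2)) \<and> \<phi>' + T + 2 \<le> \<phi>)"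
    using achieves_weaken[OF assms(3)[OF j(2,1)] order_refl] by simp
  then show "\<exists>T'. achieves c s T' (\<lambda>s'. \<exists>\<phi>'. (\<exists>j\<le>N. I j s' \<and> \<phi>' = (N - j) * (T + 2)) \<and> \<phi>' + T' + 2 \<le> \<phi>)"
    by (rule exI)
next
  fix \<phi> s
  assume "\<exists>j\<le>N. I j s \<and> \<phi> = (N - j) * (T + 2)" "\<not> holds b s"
  then obtain j where j: "j \<le> N" "I j s" "\<not> holds b s"
    by blast
  then have "j = N"
    using assms(2)[OF j(2,1)] by simp
  then show "Q s"
    using assms(4) j(2) by simp
qed (use assms(5) in auto)

text \<open>The final state in \<open>achieves\<close> is determined only up to its program counter,
  so \<open>Q\<close> has to be insensitive to it.\<close>

lemma achieves_halts_within:
  assumes "achieves c s T Q" "pc s = 0" "\<And>s' l. Q s' \<Longrightarrow> Q (s'\<lparr>pc := l\<rparr>)"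
  shows "\<exists>t s'. halts_within (compile 0 c) s t s' \<and> Q s' \<and> t \<le> T"
proof -
  have "code_at (compile 0 c) 0 (compile 0 c)"
    unfolding code_at_def by (intro exI[of _ "[]"]) simp
  with assms(1) obtain t s' where t: "t \<le> T" "Q s'"
    "run (compile 0 c) t (s\<lparr>pc := 0\<rparr>) = s'\<lparr>pc := 0 + code_length c\<rparr>"
    by (rule achievesE)
  moreover have "s\<lparr>pc := 0\<rparr> = s"
    using assms(2) by simp
  ultimately have "halts_within (compile 0 c) s t (s'\<lparr>pc := code_length c\<rparr>)"
    by (simp add: halts_within_def halted_def)
  then show ?thesis
    using t(1) assms(3)[OF t(2)] by blast
qed

section \<open>Voronoi diagrams and breadth-first search\<close>

locale balanced_vertex_input =
  fixes n :: nat and E :: "nat set set" and \<pi> :: "nat \<Rightarrow> real" and S :: "nat list"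
    and adj :: "nat \<Rightarrow> nat list"
  assumes inst: "balanced_vertex_instance {..<n} E \<pi> S"
    and adj: "adjacency_lists n E adj"
begin

abbreviation dist :: "nat \<Rightarrow> nat \<Rightarrow> nat" where
  "dist \<equiv> gdist {..<n} E"

abbreviation p :: nat where
  "p \<equiv> length S"

lemma simple: "simple_graph {..<n} E" and connected: "connected_graph {..<n} E"
  and cost_nonneg: "v < n \<Longrightarrow> \<pi> v \<ge> 0"
  and distinct_S: "distinct S" and set_S: "set S \<subseteq> {..<n}"
  and nontrivial: "{..<n} - set S \<noteq> {}"
  using inst by (auto simp: balanced_vertex_instance_def proper_vertex_list_def)

lemma p_less_n: "p < n"
proof -
  have "set S \<subset> {..<n}"
    using set_S nontrivial by blast
  then show ?thesis
    using psubset_card_mono[of "{..<n}" "set S"] distinct_S by (simp add: distinct_card)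
qed

lemma S_less: "i < p \<Longrightarrow> S ! i < n"
  using set_S nth_mem by blast

lemma set_adj: "v < n \<Longrightarrow> set (adj v) = {u. {v, u} \<in> E}"
  and distinct_adj: "v < n \<Longrightarrow> distinct (adj v)"
  using adj by (auto simp: adjacency_lists_def)

lemma adj_less: "v < n \<Longrightarrow> w \<in> set (adj v) \<Longrightarrow> w < n"
  using simple_graph_edge(2)[OF simple] set_adj by auto

lemma sum_length_adj: "(\<Sum>v<n. length (adj v)) = 2 * card E"
proof -
  have "length (adj v) = card {u. {v, u} \<in> E}" if "v < n" for v
    using distinct_card[OF distinct_adj[OF that]] set_adj[OF that] by simp
  then show ?thesis
    using sum_degrees[OF simple] by simp
qed

lemma dist_less: "u < n \<Longrightarrow> v < n \<Longrightarrow> dist u v < n"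
  using gdist_less_card[OF connected] by simp

text \<open>Distances are shifted by one, as in the table of the program, and \<open>n + 1\<close> plays the role of
  the infinite distance to an empty list.\<close>

definition nearest :: "nat \<Rightarrow> nat \<Rightarrow> nat \<Rightarrow> nat \<Rightarrow> bool" where
  "nearest u i d k \<longleftrightarrow>
     (\<forall>j<i. d \<le> Suc (dist u (S ! j))) \<and>
     (if i = 0 then d = Suc n \<and> k = 0
      else k < i \<and> d = Suc (dist u (S ! k)) \<and> (\<forall>j<k. d < Suc (dist u (S ! j))))"

lemma nearest_0: "nearest u 0 (Suc n) 0"
  by (simp add: nearest_def)

text \<open>Strict comparison keeps the earlier index on ties, which is the priority rule. Distances
  are below \<open>n\<close>, so the first element of \<open>S\<close> always replaces the infinite
  value \<open>n + 1\<close>.\<close>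

lemma nearest_Suc:
  assumes "nearest u i d k" "i < p" "u < n"
  shows "Suc (dist u (S ! i)) < d \<Longrightarrow> nearest u (Suc i) (Suc (dist u (S ! i))) i"
    and "\<not> Suc (dist u (S ! i)) < d \<Longrightarrow> nearest u (Suc i) d k"
proof -
  have "dist u (S ! i) < n"
    using dist_less[OF assms(3) S_less[OF assms(2)]] .
  then show "Suc (dist u (S ! i)) < d \<Longrightarrow> nearest u (Suc i) (Suc (dist u (S ! i))) i"
    and "\<not> Suc (dist u (S ! i)) < d \<Longrightarrow> nearest u (Suc i) d k"
    using assms(1) by (auto simp: nearest_def less_Suc_eq split: if_splits)
qed

text \<open>A shifted distance of one is the distance zero, attained only by members of
  \<open>S\<close>; for empty \<open>S\<close> the value \<open>n + 1\<close> exceeds one as well.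
  The program thus recognises candidates without searching \<open>S\<close> again.\<close>

lemma nearest_greater_1_iff:
  assumes "nearest v p d k" "v < n"
  shows "1 < d \<longleftrightarrow> v \<notin> set S"
proof -
  have 0: "dist v (S ! j) = 0 \<longleftrightarrow> v = S ! j" if "j < p" for j
    using gdist_eq_0_iff[OF connected] assms(2) S_less[OF that] by simp
  show ?thesis
  proof (cases "p = 0")
    case True
    then show ?thesis
      using assms(1,2) unfolding nearest_def by simp
  next
    case False
    then have k: "k < p" "d = Suc (dist v (S ! k))" "\<forall>j<p. d \<le> Suc (dist v (S ! j))"
      using assms(1) by (auto simp: nearest_def)
    show ?thesis
    proof
      assume "1 < d"
      then show "v \<notin> set S"
        using k(3) 0 by (fastforce simp: in_set_conv_nth)
    next
      assume "v \<notin> set S"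
      then show "1 < d"
        using k 0[OF k(1)] nth_mem[OF k(1)] by fastforce
    qed
  qed
qed

section \<open>Loads after a vertex has been appended\<close>

lemma territory_iff_first_minimum:
  assumes "u < n" "k < length L" "i < length L"
    and "\<And>j. j < length L \<Longrightarrow> dist u (L ! k) \<le> dist u (L ! j)"
    and "\<And>j. j < k \<Longrightarrow> dist u (L ! k) < dist u (L ! j)"
  shows "u \<in> territory {..<n} E L i \<longleftrightarrow> i = k"
proof -
  have "gdist_list {..<n} E u L = dist u (L ! k)"
    unfolding gdist_list_def using assms(2,4) by (intro Min_eqI) (fastforce simp: in_set_conv_nth)+
  then show ?thesis
    using assms by (auto simp: territory_def) (metis linorder_neqE_nat order_less_irrefl leD)
qed

definition owner :: "nat \<Rightarrow> nat \<Rightarrow> nat \<Rightarrow> nat \<Rightarrow> nat" where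
  "owner v u d k = (if Suc (dist u v) < d then p else k)"

text \<open>For empty \<open>S\<close> the infinite \<open>d = n + 1\<close> exceeds
  \<open>Suc (dist u v)\<close>, so the new vertex owns everything and the dummy index in
  \<open>k\<close> is never selected.\<close>

lemma owner_less: "nearest u p d k \<Longrightarrow> u < n \<Longrightarrow> v < n \<Longrightarrow> owner v u d k < Suc p"
  using dist_less[of u v] by (auto simp: owner_def nearest_def split: if_splits)

lemma territory_iff_owner:
  assumes "nearest u p d k" "u < n" "v < n" "i < Suc p"
  shows "u \<in> territory {..<n} E (S @ [v]) i \<longleftrightarrow> owner v u d k = i"
proof -
  let ?k = "owner v u d k"
  have nth: "(S @ [v]) ! j = (if j < p then S ! j else v)" if "j < Suc p" for j
    using that by (auto simp: nth_append less_Suc_eq)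
  have k: "?k < Suc p"
    using owner_less[OF assms(1-3)] .
  have v: "dist u v < n"
    using dist_less[OF assms(2,3)] .
  have 1: "dist u ((S @ [v]) ! ?k) \<le> dist u ((S @ [v]) ! j)" if "j < length (S @ [v])" for j
    using assms(1) k v that nth[OF k] nth[of j]
    by (fastforce simp: owner_def nearest_def not_less split: if_splits)
  have 2: "dist u ((S @ [v]) ! ?k) < dist u ((S @ [v]) ! j)" if "j < ?k" for j
    using assms(1) k v that nth[OF k] nth[of j]
    by (fastforce simp: owner_def nearest_def not_less split: if_splits)
  show ?thesis
    using territory_iff_first_minimum[of u ?k "S @ [v]" i, OF assms(2) _ _ 1 2] k assms(4) by auto
qed

text \<open>The sum with an indicator is the form that a single loop over \<open>u\<close>
  accumulates for all \<open>i\<close> at once.\<close>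

lemma territory_load_owner:
  assumes "\<And>u. u < n \<Longrightarrow> nearest u p (D u) (K u)" "v < n" "i < Suc p"
  shows "territory_load {..<n} E \<pi> (S @ [v]) i =
    (\<Sum>u<n. if owner v u (D u) (K u) = i then \<pi> u else 0)"
proof -
  have "u \<in> territory {..<n} E (S @ [v]) i \<longleftrightarrow> owner v u (D u) (K u) = i" if "u < n" for u
    using territory_iff_owner[OF assms(1)[OF that] that assms(2,3)] .
  then have "territory {..<n} E (S @ [v]) i = {u \<in> {..<n}. owner v u (D u) (K u) = i}"
    by (auto simp: territory_def)
  then show ?thesis
    by (simp only: territory_load_def sum.inter_filter finite_lessThan)
qed

text \<open>Costs are nonnegative, so an additional 0 does not change the maximum. This justifies
  starting the search for it from 0.\<close>

lemma max_load_eq: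
  assumes "v < n"
  shows "max_load {..<n} E \<pi> (S @ [v]) =
    Max (insert 0 (territory_load {..<n} E \<pi> (S @ [v]) ` {..<Suc p}))"
proof -
  let ?X = "territory_load {..<n} E \<pi> (S @ [v]) ` {..<Suc p}"
  have "0 \<le> territory_load {..<n} E \<pi> (S @ [v]) 0"
    unfolding territory_load_def using cost_nonneg by (intro sum_nonneg) (simp add: territory_def)
  also have "\<dots> \<le> Max ?X"
    by (intro Max_ge) auto
  finally have "Max (insert 0 ?X) = Max ?X"
    by (subst Max_insert) (auto intro: max_absorb2)
  then show ?thesis
    by (simp add: max_load_def)
qed

text \<open>The list \<open>q\<close> is the queue together with all vertices that have left it; the first \<open>h\<close> vertices
  are finished, and of the next one the first \<open>j\<close> neighbours have been inspected.\<close>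

definition bfs_inv :: "nat \<Rightarrow> nat \<Rightarrow> nat \<Rightarrow> nat list \<Rightarrow> bool" where
  "bfs_inv u h j q \<longleftrightarrow>
     distinct q \<and> set q \<subseteq> {..<n} \<and> u \<in> set q \<and> sorted (map (dist u) q) \<and> h \<le> length q \<and>
     (\<forall>x\<in>set (take h q). set (adj x) \<subseteq> set q) \<and>
     (h < length q \<longrightarrow> set (take j (adj (q ! h))) \<subseteq> set q \<and>
        (\<forall>y\<in>set q. dist u y \<le> Suc (dist u (q ! h))))"

section \<open>Breadth-first search: preservation of the invariant and completeness\<close>

lemma bfs_inv_start: "u < n \<Longrightarrow> bfs_inv u 0 0 [u]"
  by (simp add: bfs_inv_def)

text \<open>By induction on the distance, the predecessor \<open>x\<close> of \<open>w\<close> is in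
  \<open>q\<close>. Since \<open>q\<close> is sorted by distance and \<open>x\<close> is strictly
  closer than \<open>q ! h\<close>, it stands before position \<open>h\<close>, hence is finished,
  and so its neighbour \<open>w\<close> is in \<open>q\<close>. Once \<open>h\<close> has reached
  the end of \<open>q\<close>, the last premise is void and every vertex is reached.\<close>

lemma bfs_inv_reached:
  assumes "bfs_inv u h j q" "u < n" "w < n" "h < length q \<longrightarrow> dist u w \<le> dist u (q ! h)"
  shows "w \<in> set q"
  using assms(3,4)
proof (induction "dist u w" arbitrary: w rule: less_induct)
  case less
  show ?case
  proof (cases "w = u")
    case True
    then show ?thesis
      using assms(1) by (simp add: bfs_inv_def)
  next
    case False
    then obtain x where x: "x < n" "{x, w} \<in> E" "Suc (dist u x) = dist u w"
      using gdist_predecessor[OF connected, of u w] assms(2) less.prems by auto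
    then have "x \<in> set q"
      using less.hyps less.prems by auto
    then obtain i where i: "i < length q" "q ! i = x"
      by (auto simp: in_set_conv_nth)
    have "i < h"
    proof (rule ccontr)
      assume "\<not> i < h"
      then have "dist u (q ! h) \<le> dist u (q ! i)"
        using assms(1) i(1) sorted_nth_mono[of "map (dist u) q" h i] by (simp add: bfs_inv_def)
      then show False
        using x(3) i less.prems(2) \<open>\<not> i < h\<close> by simp
    qed
    then have "x \<in> set (take h q)"
      using i by (metis in_set_conv_nth length_take min_less_iff_conj nth_take)
    then have "set (adj x) \<subseteq> set q"
      using assms(1) by (simp add: bfs_inv_def)
    then show ?thesis
      using set_adj[OF x(1)] x(2) by auto
  qed
qed

lemma bfs_inv_end:
  assumes "bfs_inv u h j q" "u < n" "\<not> h < length q"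
  shows "set q = {..<n}"
  using bfs_inv_reached[OF assms(1,2)] assms by (auto simp: bfs_inv_def)

lemma bfs_inv_old:
  assumes "bfs_inv u h j q" "h < length q" "j < length (adj (q ! h))" "adj (q ! h) ! j \<in> set q"
  shows "bfs_inv u h (Suc j) q"
  using assms by (simp add: bfs_inv_def take_Suc_conv_app_nth)

text \<open>The edge gives one inequality. For the other, all vertices no farther than
  \<open>q ! h\<close> are already in \<open>q\<close> by \<open>bfs_inv_reached\<close>. Appending
  keeps \<open>q\<close> sorted because no entry exceeds the distance of \<open>q ! h\<close> by
  more than one.\<close>

lemma bfs_inv_new:
  assumes "bfs_inv u h j q" "h < length q" "u < n"
    and "j < length (adj (q ! h))" "w = adj (q ! h) ! j" "w \<notin> set q"
  shows "bfs_inv u h (Suc j) (q @ [w])" "dist u w = Suc (dist u (q ! h))"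
proof -
  have x: "q ! h < n"
    using assms(1,2) nth_mem[of h q] unfolding bfs_inv_def by blast
  have w: "w \<in> set (adj (q ! h))"
    using assms(4,5) by simp
  then have wn: "w < n" and edge: "{q ! h, w} \<in> E"
    using adj_less[OF x] set_adj[OF x] by auto
  have "dist u w \<le> Suc (dist u (q ! h))"
    using gdist_step[OF connected _ _ _ edge] assms(3) x wn by simp
  moreover have "\<not> dist u w \<le> dist u (q ! h)"
    using bfs_inv_reached[OF assms(1,3) wn] assms(6) by blast
  ultimately show eq: "dist u w = Suc (dist u (q ! h))"
    by simp
  show "bfs_inv u h (Suc j) (q @ [w])"
    using assms wn eq
    by (auto simp: bfs_inv_def nth_append sorted_append take_Suc_conv_app_nth)
qed

text \<open>The bound on the distances in \<open>q\<close> is inherited by the next head, which is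
  no closer than the old one as \<open>q\<close> is sorted.\<close>

lemma bfs_inv_next:
  assumes "bfs_inv u h (length (adj (q ! h))) q" "h < length q"
  shows "bfs_inv u (Suc h) 0 q"
proof -
  have le: "dist u (q ! h) \<le> dist u (q ! Suc h)" if "Suc h < length q"
    using assms that sorted_nth_mono[of "map (dist u) q" h "Suc h"] by (simp add: bfs_inv_def)
  have "dist u y \<le> Suc (dist u (q ! Suc h))" if "y \<in> set q" "Suc h < length q" for y
  proof -
    have "dist u y \<le> Suc (dist u (q ! h))"
      using assms that(1) by (simp add: bfs_inv_def)
    then show ?thesis
      using le[OF that(2)] by simp
  qed
  then show ?thesis
    using assms by (simp add: bfs_inv_def take_Suc_conv_app_nth)
qed

end

section \<open>The program\<close>

text \<open>Registers below 15 keep their values throughout the inner subroutines, the others are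
  scratch. Register 1 is avoided because the simplifier rewrites the numeral \<open>1\<close> to \<open>Suc 0\<close>. \<open>BEST\<close>,
  \<open>CUR\<close> and \<open>TMP\<close> are real registers. \<open>OUT\<close> is still 0 when \<open>prepare\<close> uses it as an address.\<close>

abbreviation (input) "OUT \<equiv> 0 :: nat"
abbreviation (input) "NUM \<equiv> 2 :: nat"
abbreviation (input) "LEN \<equiv> 3 :: nat"
abbreviation (input) "ONE \<equiv> 4 :: nat"
abbreviation (input) "TWO \<equiv> 5 :: nat"
abbreviation (input) "LEN1 \<equiv> 6 :: nat"
abbreviation (input) "OFFS \<equiv> 7 :: nat"
abbreviation (input) "QUEUE \<equiv> 8 :: nat"
abbreviation (input) "RADIUS \<equiv> 9 :: nat"
abbreviation (input) "NEAR \<equiv> 10 :: nat"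
abbreviation (input) "ROWS \<equiv> 11 :: nat"
abbreviation (input) "FOUND \<equiv> 12 :: nat"
abbreviation (input) "ROW \<equiv> 13 :: nat"
abbreviation (input) "U \<equiv> 14 :: nat"
abbreviation (input) "I \<equiv> 15 :: nat"
abbreviation (input) "ADR \<equiv> 16 :: nat"
abbreviation (input) "H \<equiv> 17 :: nat"
abbreviation (input) "T \<equiv> 18 :: nat"
abbreviation (input) "X \<equiv> 19 :: nat"
abbreviation (input) "Y \<equiv> 20 :: nat"
abbreviation (input) "A \<equiv> 21 :: nat"
abbreviation (input) "Z \<equiv> 22 :: nat"
abbreviation (input) "D \<equiv> 23 :: nat"
abbreviation (input) "W \<equiv> 24 :: nat"
abbreviation (input) "K \<equiv> 25 :: nat"
abbreviation (input) "BEST \<equiv> 0 :: nat"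
abbreviation (input) "CUR \<equiv> 2 :: nat"
abbreviation (input) "TMP \<equiv> 3 :: nat"

text \<open>The input does not state the total length of the adjacency lists, so a first walk over
  them finds its end, where the table of their addresses begins; a second walk fills that
  table.\<close>

definition prepare :: com where
  "prepare =
     Block [Const ONE 1, Load NUM OUT, Load LEN ONE, Add TWO ONE ONE, Add LEN1 LEN ONE,
            Add A TWO LEN, Const I 0] ;;
     While (Less I NUM) (Block [Load X A, Add A A X, Add A A ONE, Add I I ONE]) ;;
     Block [Move OFFS A, Add QUEUE OFFS NUM, Add RADIUS QUEUE NUM, Add NEAR RADIUS NUM,
            Add ROWS NEAR NUM, Add A TWO LEN, Const I 0] ;;
     While (Less I NUM)
       (Block [Add ADR OFFS I, Store ADR A, Load X A, Add A A X, Add A A ONE, Add I I ONE])"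

text \<open>A cell of the distance table holds the distance plus one. As memory beyond the input is
  initially 0, the unvisited vertices are those whose cell is 0.\<close>

definition scan_neighbours :: com where
  "scan_neighbours =
     While (Less A Z)
       (Block [Add A A ONE, Load W A, Add ADR ROW W, Load Y ADR] ;;
        Cond (Less Y ONE) (Block [Store ADR D, Store T W, Add T T ONE]) (Block []))"

text \<open>\<open>A\<close> starts at the length cell of the adjacency list and is advanced before
  each read, so the loop bound \<open>Z\<close> is the address of the last neighbour.
  \<open>D\<close> becomes the cell value for newly found neighbours: the distance of
  \<open>X\<close> plus two.\<close>

definition bfs :: com where
  "bfs =
     Block [Add ADR ROW U, Store ADR ONE, Store QUEUE U, Move H QUEUE, Add T QUEUE ONE] ;;
     While (Less H T)
       (Block [Load X H, Add ADR ROW X, Load D ADR, Add D D ONE, Add ADR OFFS X, Load A ADR,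
               Load Z A, Add Z Z A] ;;
        scan_neighbours ;;
        Block [Add H H ONE])"

definition find_nearest :: com where
  "find_nearest =
     Block [Add D NUM ONE, Const K 0, Const I 0] ;;
     While (Less I LEN)
       (Block [Add ADR TWO I, Load W ADR, Add ADR ROW W, Load Y ADR] ;;
        Cond (Less Y D) (Block [Move D Y, Move K I]) (Block []) ;;
        Block [Add I I ONE]) ;;
     Block [Add ADR RADIUS U, Store ADR D, Add ADR NEAR U, Store ADR K]"

definition build_tables :: com where
  "build_tables =
     Block [Const U 0, Move ROW ROWS] ;;
     While (Less U NUM) (bfs ;; find_nearest ;; Block [Add ROW ROW NUM, Add U U ONE])"

text \<open>The \<open>p + 1\<close> loads are kept in the real cells from address \<open>n\<close>
  on, right behind the costs.\<close>

definition clear_loads :: com where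
  "clear_loads =
     Block [RZero TMP, Const I 0] ;;
     While (Less I LEN1) (Block [Add ADR NUM I, RStore ADR TMP, Add I I ONE])"

text \<open>The column of the candidate is read with stride \<open>n\<close>. The entry in row
  \<open>u\<close> is the distance from \<open>u\<close> to the candidate, with the arguments in the
  order used by \<open>territory\<close>.\<close>

definition add_loads :: com where
  "add_loads =
     Block [Const X 0, Add A ROWS U] ;;
     While (Less X NUM)
       (Block [Load Y A, Add ADR RADIUS X, Load D ADR] ;;
        Cond (Less Y D) (Block [Move K LEN]) (Block [Add ADR NEAR X, Load K ADR]) ;;
        Block [Add ADR NUM K, RLoad TMP ADR, RLoad CUR X, RAdd TMP TMP CUR, RStore ADR TMP,
               Add A A NUM, Add X X ONE])"

definition find_max :: com where
  "find_max =
     Block [RZero CUR, Const I 0] ;;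
     While (Less I LEN1)
       (Block [Add ADR NUM I, RLoad TMP ADR] ;;
        Cond (RLess CUR TMP) (Block [RMove CUR TMP]) (Block []) ;;
        Block [Add I I ONE])"

definition record_best :: com where
  "record_best = Block [Move OUT U, RMove BEST CUR, Const FOUND 1]"

text \<open>A shifted distance above one singles out the vertices outside \<open>S\<close>.
  \<open>FOUND\<close> makes the first of them be recorded whatever \<open>BEST\<close>
  contains.\<close>

definition search :: com where
  "search =
     Block [Const U 0, Const FOUND 0] ;;
     While (Less U NUM)
       (Block [Add ADR RADIUS U, Load D ADR] ;;
        Cond (Less ONE D)
          (clear_loads ;; add_loads ;; find_max ;;
           Cond (Less FOUND ONE) record_best (Cond (RLess CUR BEST) record_best (Block [])))
          (Block []) ;;
        Block [Add U U ONE])"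

definition balanced_vertex_program :: com where
  "balanced_vertex_program = prepare ;; build_tables ;; search"

section \<open>Memory layout and encoding of the input\<close>

context balanced_vertex_input
begin

text \<open>The adjacency list of \<open>v\<close> starts at \<open>loc v\<close>, and the input ends before \<open>free = loc n\<close>. From
  there on memory consists of blocks of \<open>n\<close> cells: the addresses \<open>loc v\<close>, the queue, the
  distances to \<open>S\<close>, the indices of the territories, and the \<open>n\<close> rows of the distance table.\<close>

definition loc :: "nat \<Rightarrow> nat" where
  "loc v = 2 + p + (\<Sum>w<v. Suc (length (adj w)))"

abbreviation free :: nat where
  "free \<equiv> loc n"

definition row :: "nat \<Rightarrow> nat" where
  "row u = free + 4 * n + u * n"

definition graph_in :: "(nat \<Rightarrow> nat) \<Rightarrow> bool" where
  "graph_in m \<longleftrightarrow>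
     (\<forall>i<p. m (2 + i) = S ! i) \<and>
     (\<forall>v<n. m (loc v) = length (adj v) \<and> (\<forall>j<length (adj v). m (Suc (loc v + j)) = adj v ! j))"

lemma loc_Suc: "loc (Suc v) = Suc (loc v + length (adj v))"
  by (simp add: loc_def)

lemma loc_mono: "u \<le> v \<Longrightarrow> loc u \<le> loc v"
  unfolding loc_def by (intro add_left_mono sum_mono2) auto

lemma loc_bounds:
  assumes "v < n"
  shows "loc v < free" "j < length (adj v) \<Longrightarrow> Suc (loc v + j) < free"
  using loc_mono[of "Suc v" n] assms by (auto simp: loc_Suc)

lemma p_bound: "i < p \<Longrightarrow> 2 + i < free"
  by (simp add: loc_def)

lemma graph_in_cong:
  assumes "graph_in m" "\<And>a. a < free \<Longrightarrow> m' a = m a"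
  shows "graph_in m'"
  using assms loc_bounds p_bound by (simp add: graph_in_def)

lemma row_Suc: "row (Suc u) = row u + n"
  by (simp add: row_def)

lemma row_mono: "u < v \<Longrightarrow> row u + n \<le> row v"
  using mult_le_mono1[of "Suc u" v n] by (simp add: row_def)

lemma row_bound: "free + 4 * n \<le> row u"
  by (simp add: row_def)

lemma encode_input_nth:
  "encode_input n adj S ! a =
    (if a = 0 then n else if a = 1 then p else if a < 2 + p then S ! (a - 2)
     else concat (map (\<lambda>v. length (adj v) # adj v) [0..<n]) ! (a - (2 + p)))"
  by (auto simp: encode_input_def nth_append nth_Cons' numeral_2_eq_2)

lemma length_concat_adj:
  assumes "v \<le> n"
  shows "length (concat (map (\<lambda>v. length (adj v) # adj v) [0..<v])) + 2 + p = loc v"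
  by (induction v) (auto simp: loc_def)

text \<open>The concatenation is split at the block of \<open>v\<close>; everything before it has
  length \<open>loc v\<close>.\<close>

lemma encode_input_adj:
  assumes "v < n" "j < Suc (length (adj v))"
  shows "encode_input n adj S ! (loc v + j) = (length (adj v) # adj v) ! j"
proof -
  let ?f = "\<lambda>v. length (adj v) # adj v"
  have "[0..<n] = [0..<v] @ v # [Suc v..<n]"
    using upt_add_eq_append[of 0 v "n - v"] upt_conv_Cons[of v n] assms(1) by simp
  then have "concat (map ?f [0..<n]) = concat (map ?f [0..<v]) @ ?f v @ concat (map ?f [Suc v..<n])"
    by simp
  then have "encode_input n adj S =
      (n # p # S @ concat (map ?f [0..<v])) @ ?f v @ concat (map ?f [Suc v..<n])"
    by (simp add: encode_input_def)
  moreover have "length (n # p # S @ concat (map ?f [0..<v])) = loc v"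
    using length_concat_adj[of v] assms(1) by simp
  ultimately have "encode_input n adj S ! (loc v + j) = (?f v @ concat (map ?f [Suc v..<n])) ! j"
    by (metis nth_append_length_plus)
  then show ?thesis
    using assms(2) by (simp only: nth_append length_Cons if_True)
qed

lemma length_encode_input: "length (encode_input n adj S) = free"
  using length_concat_adj[of n] by (simp add: encode_input_def)

lemma graph_in_initial: "graph_in (mem (initial_config n adj \<pi> S))"
  unfolding graph_in_def
proof (intro conjI allI impI)
  fix i assume "i < p"
  then show "mem (initial_config n adj \<pi> S) (2 + i) = S ! i"
    using p_bound[of i] by (simp add: initial_config_def length_encode_input encode_input_nth)
next
  fix v assume "v < n"
  then show "mem (initial_config n adj \<pi> S) (loc v) = length (adj v)"
    using loc_bounds(1)[of v] encode_input_adj[of v 0]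
    by (simp add: initial_config_def length_encode_input)
next
  fix v j assume "v < n" "j < length (adj v)"
  then show "mem (initial_config n adj \<pi> S) (Suc (loc v + j)) = adj v ! j"
    using loc_bounds(2)[of v j] encode_input_adj[of v "Suc j"]
    by (simp add: initial_config_def length_encode_input)
qed

definition env :: "config \<Rightarrow> bool" where
  "env s \<longleftrightarrow>
     reg s NUM = n \<and> reg s LEN = p \<and> reg s ONE = 1 \<and> reg s TWO = 2 \<and> reg s LEN1 = Suc p \<and>
     reg s OFFS = free \<and> reg s QUEUE = free + n \<and> reg s RADIUS = free + 2 * n \<and>
     reg s NEAR = free + 3 * n \<and> reg s ROWS = free + 4 * n \<and>
     graph_in (mem s) \<and> (\<forall>v<n. mem s (free + v) = loc v) \<and> (\<forall>v<n. rmem s v = \<pi> v)"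

text \<open>The zero cells in the conclusion become the unvisited entries of the distance
  table.\<close>

lemma prepare_achieves:
  "achieves prepare (initial_config n adj \<pi> S) (18 + 14 * n)
     (\<lambda>s. env s \<and> (\<forall>a\<ge>free + n. mem s a = 0))"
proof -
  define m0 where "m0 = mem (initial_config n adj \<pi> S)"
  have m0: "graph_in m0" "m0 0 = n" "m0 (Suc 0) = p" "\<And>a. a \<ge> free \<Longrightarrow> m0 a = 0"
    using graph_in_initial encode_input_nth[of 0] encode_input_nth[of 1]
    by (auto simp: m0_def initial_config_def length_encode_input) (simp_all add: loc_def)
  let ?J = "\<lambda>s. reg s NUM = n \<and> reg s LEN = p \<and> reg s ONE = 1 \<and> reg s TWO = 2 \<and>
    reg s LEN1 = Suc p \<and> (\<forall>v<n. rmem s v = \<pi> v)"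
  let ?J2 = "\<lambda>s. ?J s \<and> 
     reg s OFFS = free \<and> reg s QUEUE = free + n \<and> reg s RADIUS = free + 2 * n \<and>
     reg s NEAR = free + 3 * n \<and> reg s ROWS = free + 4 * n"
  have deg: "m (loc j) = length (adj j)" if "graph_in m" "j < n" for j m
    using that by (simp add: graph_in_def)
  have graph_upd: "graph_in (m(free + i := x))" if "graph_in m" for m i x
    using that by (rule graph_in_cong) simp
  show ?thesis
    unfolding prepare_def
  proof (rule achieves_Seq)
    show "achieves (Block [Const ONE 1, Load NUM OUT, Load LEN ONE, Add TWO ONE ONE,
        Add LEN1 LEN ONE, Add A TWO LEN, Const I 0]) (initial_config n adj \<pi> S) 7
        (\<lambda>s. ?J s \<and> mem s = m0 \<and> reg s A = loc 0 \<and> reg s I = 0)"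
      using m0 unfolding m0_def
      by (intro achieves_Block) (simp_all add: initial_config_def loc_def)
  next
    fix s :: config
    assume s: "?J s \<and> mem s = m0 \<and> reg s A = loc 0 \<and> reg s I = 0"
    show "achieves (While (Less I NUM) (Block [Load X A, Add A A X, Add A A ONE, Add I I ONE]) ;;
      Block [Move OFFS A, Add QUEUE OFFS NUM, Add RADIUS QUEUE NUM, Add NEAR RADIUS NUM,
            Add ROWS NEAR NUM, Add A TWO LEN, Const I 0] ;;
      While (Less I NUM)
        (Block [Add ADR OFFS I, Store ADR A, Load X A, Add A A X, Add A A ONE, Add I I ONE]))
       s ((n * (4 + 2) + 2) + (7 + (n * (6 + 2) + 2))) (\<lambda>s. env s \<and> (\<forall>a\<ge>free + n. mem s a = 0))"
    proof (rule achieves_Seq)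
      show "achieves (While (Less I NUM) (Block [Load X A, Add A A X, Add A A ONE, Add I I ONE]))
        s (n * (4 + 2) + 2) (\<lambda>s. ?J s \<and> mem s = m0 \<and> reg s A = free)"
      proof (rule achieves_counting_While[where N = n and T = 4 and
            I = "\<lambda>j s. ?J s \<and> mem s = m0 \<and> reg s A = loc j \<and> reg s I = j"], goal_cases)
        case (3 j s)
        then show ?case
          using deg[OF m0(1)] by (intro achieves_Block) (simp_all add: loc_Suc)
      qed (use s in simp_all)
    next
      fix s :: config
      assume s: "?J s \<and> mem s = m0 \<and> reg s A = free"
      show "achieves (Block [Move OFFS A, Add QUEUE OFFS NUM, Add RADIUS QUEUE NUM,
          Add NEAR RADIUS NUM, Add ROWS NEAR NUM, Add A TWO LEN, Const I 0] ;;
        While (Less I NUM)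
          (Block [Add ADR OFFS I, Store ADR A, Load X A, Add A A X, Add A A ONE, Add I I ONE]))
         s (7 + (n * (6 + 2) + 2)) (\<lambda>s. env s \<and> (\<forall>a\<ge>free + n. mem s a = 0))"
      proof (rule achieves_Seq)
        show "achieves (Block [Move OFFS A, Add QUEUE OFFS NUM, Add RADIUS QUEUE NUM,
          Add NEAR RADIUS NUM, Add ROWS NEAR NUM, Add A TWO LEN, Const I 0]) s 7
          (\<lambda>s. ?J2 s \<and> mem s = m0 \<and> reg s A = loc 0 \<and> reg s I = 0)"
          using s by (intro achieves_Block) (simp_all add: loc_def)
      next
        fix s :: config
        assume s: "?J2 s \<and> mem s = m0 \<and> reg s A = loc 0 \<and> reg s I = 0"
        show "achieves (While (Less I NUM)
            (Block [Add ADR OFFS I, Store ADR A, Load X A, Add A A X, Add A A ONE, Add I I ONE]))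
           s (n * (6 + 2) + 2) (\<lambda>s. env s \<and> (\<forall>a\<ge>free + n. mem s a = 0))"
        proof (rule achieves_counting_While[where N = n and T = 6 and
            I = "\<lambda>j s. ?J2 s \<and> graph_in (mem s) \<and> (\<forall>v<j. mem s (free + v) = loc v) \<and>
                     (\<forall>a\<ge>free + j. mem s a = 0) \<and> reg s A = loc j \<and> reg s I = j"], goal_cases)
          case 1
          then show ?case
            using s m0 by simp
        next
          case (3 j s)
          then show ?case
            using deg[of "mem s" j] loc_bounds(1)[of j]
            by (intro achieves_Block) (simp_all add: loc_Suc graph_upd less_Suc_eq all_conj_distrib)
        qed (simp_all add: env_def)
      qed simp
    qed simp
  qed simp
qed

section \<open>Breadth-first search on the machine\<close>

text \<open>\<open>s0\<close> is the state before the search from \<open>u\<close>. The frame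
  condition permits changes only in the queue block and in row \<open>u\<close>, so the input and
  the rows of other vertices survive.\<close>

definition bfs_state :: "config \<Rightarrow> nat \<Rightarrow> nat \<Rightarrow> nat \<Rightarrow> nat list \<Rightarrow> config \<Rightarrow> bool" where
  "bfs_state s0 u h j q s \<longleftrightarrow>
     (\<forall>r<15. reg s r = reg s0 r) \<and> rmem s = rmem s0 \<and>
     (\<forall>a. (a < free + n \<or> free + 2 * n \<le> a) \<and> (a < row u \<or> row u + n \<le> a) \<longrightarrow>
        mem s a = mem s0 a) \<and>
     bfs_inv u h j q \<and> (\<forall>i<length q. mem s (free + n + i) = q ! i) \<and>
     (\<forall>w<n. mem s (row u + w) = (if w \<in> set q then Suc (dist u w) else 0)) \<and>
     reg s H = free + n + h \<and> reg s T = free + n + length q"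

lemma bfs_inv_length: "bfs_inv u h j q \<Longrightarrow> length q \<le> n"
  using card_mono[of "{..<n}" "set q"] by (simp add: bfs_inv_def distinct_card)

lemma bfs_inv_nth: "bfs_inv u h j q \<Longrightarrow> i < length q \<Longrightarrow> q ! i < n"
  using nth_mem[of i q] unfolding bfs_inv_def by blast

lemma bfs_state_push:
  assumes "bfs_state s0 u h j q s" "h < length q" "u < n"
    and "j < length (adj (q ! h))" "w = adj (q ! h) ! j" "w \<notin> set q"
    and "\<And>r. r \<noteq> T \<Longrightarrow> reg s' r = reg s r" "reg s' T = Suc (reg s T)"
    and "mem s' = (mem s)(row u + w := Suc (Suc (dist u (q ! h))), free + n + length q := w)"
    and "rmem s' = rmem s"
  shows "bfs_state s0 u h (Suc j) (q @ [w]) s'"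
proof -
  have inv: "bfs_inv u h j q"
    using assms(1) by (simp add: bfs_state_def)
  note new = bfs_inv_new[OF inv assms(2-6)]
  \<comment> \<open>The extended queue still consists of distinct vertices and thus has at most
    \<open>n\<close> entries, so the new one stays inside the queue block.\<close>
  have len: "length q < n" and w: "w < n"
    using bfs_inv_length[OF new(1)] bfs_inv_nth[OF new(1), of "length q"] by simp_all
  have "mem s' (free + n + i) = (q @ [w]) ! i" if "i < length (q @ [w])" for i
    using assms(1,9) that len w row_bound[of u] by (auto simp: bfs_state_def nth_append)
  moreover have "mem s' (row u + v) = (if v \<in> set (q @ [w]) then Suc (dist u v) else 0)" if "v < n" for v
    using assms(1,9) that len new(2) row_bound[of u] by (auto simp: bfs_state_def)
  moreover have "mem s' a = mem s0 a"
    if "(a < free + n \<or> free + 2 * n \<le> a) \<and> (a < row u \<or> row u + n \<le> a)" for a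
    using assms(1,9) that len w by (auto simp: bfs_state_def)
  ultimately show ?thesis
    using assms(1,7,8,10) new(1) unfolding bfs_state_def by simp
qed

lemma bfs_state_graph:
  assumes "env s0" "bfs_state s0 u h j q s" "v < n"
  shows "mem s (free + v) = loc v" "mem s (loc v) = length (adj v)"
    "i < length (adj v) \<Longrightarrow> mem s (Suc (loc v + i)) = adj v ! i"
proof -
  have "graph_in (mem s)"
    using assms(1,2) row_bound[of u]
    by (intro graph_in_cong[of "mem s0" "mem s"]) (simp_all add: env_def bfs_state_def)
  then show "mem s (loc v) = length (adj v)"
    "i < length (adj v) \<Longrightarrow> mem s (Suc (loc v + i)) = adj v ! i"
    using assms(3) by (simp_all add: graph_in_def)
  show "mem s (free + v) = loc v"
    using assms row_bound[of u] by (simp add: env_def bfs_state_def)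
qed

text \<open>New vertices are only appended, so the head and the finished prefix are unchanged. The
  potential of the outer loop depends on that prefix alone.\<close>

lemma scan_neighbours_achieves:
  assumes "env s0" "u < n" "reg s0 ROW = row u"
    and "bfs_state s0 u h 0 q s" "h < length q" "x = q ! h"
    and "reg s A = loc x" "reg s Z = loc x + length (adj x)" "reg s D = Suc (Suc (dist u x))"
  shows "achieves scan_neighbours s (11 * length (adj x) + 2)
    (\<lambda>s'. \<exists>q'. bfs_state s0 u h (length (adj x)) q' s' \<and> h < length q' \<and> q' ! h = x \<and>
       take h q' = take h q)"
proof -
  let ?J = "\<lambda>j q' s. bfs_state s0 u h j q' s \<and> h < length q' \<and> q' ! h = x \<and> take h q' = take h q \<and>
    reg s Z = loc x + length (adj x) \<and> reg s D = Suc (Suc (dist u x))"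
  have x: "x < n"
    using assms(4-6) bfs_inv_nth[of u h 0 q h] by (simp add: bfs_state_def)
  show ?thesis
    unfolding scan_neighbours_def
  proof (rule achieves_counting_While[where N = "length (adj x)" and T = 9 and
        I = "\<lambda>j s. \<exists>q'. ?J j q' s \<and> reg s A = loc x + j"], goal_cases)
    case 1
    then show ?case
      using assms by (intro exI[of _ q]) simp
  next
    case 2
    then show ?case by auto
  next
    case (3 j s)
    then obtain q' where q': "?J j q' s" "reg s A = loc x + j"
      by blast
    let ?w = "adj x ! j"
    have w: "?w < n"
      using adj_less[OF x] 3(2) by simp
    have regs: "reg s ONE = 1" "reg s ROW = row u"
      using assms(1,3) q' by (simp_all add: bfs_state_def env_def)
    have row: "mem s (row u + ?w) = (if ?w \<in> set q' then Suc (dist u ?w) else 0)"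
      using q' w by (simp add: bfs_state_def)
    have nb: "mem s (Suc (loc x + j)) = ?w"
      using bfs_state_graph(3)[OF assms(1) _ x 3(2)] q'(1) by blast
    show ?case
    proof (rule achieves_Seq)
      show "achieves (Block [Add A A ONE, Load W A, Add ADR ROW W, Load Y ADR]) s 4
        (\<lambda>s. ?J j q' s \<and> reg s A = loc x + Suc j \<and> reg s W = ?w \<and> reg s ADR = row u + ?w \<and>
           reg s Y = (if ?w \<in> set q' then Suc (dist u ?w) else 0))"
        using q' regs row nb by (intro achieves_Block) (simp_all add: bfs_state_def)
    next
      fix s :: config
      assume s: "?J j q' s \<and> reg s A = loc x + Suc j \<and> reg s W = ?w \<and> reg s ADR = row u + ?w \<and>
        reg s Y = (if ?w \<in> set q' then Suc (dist u ?w) else 0)"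
      have one: "reg s ONE = 1"
        using assms(1) s by (simp add: bfs_state_def env_def)
      show "achieves (Cond (Less Y ONE) (Block [Store ADR D, Store T W, Add T T ONE]) (Block [])) s 5
        (\<lambda>s. \<exists>q'. ?J (Suc j) q' s \<and> reg s A = loc x + Suc j)"
      proof (rule achieves_Cond)
        assume "holds (Less Y ONE) s"
        then have new: "?w \<notin> set q'"
          using s one by (auto split: if_splits)
        let ?s = "fold exec [Store ADR D, Store T W, Add T T ONE] s"
        have T: "reg s T = free + n + length q'"
          using s by (simp add: bfs_state_def)
        have "bfs_state s0 u h (Suc j) (q' @ [?w]) ?s"
          using s one T 3(2) assms(2) new by (intro bfs_state_push[of s0 u h j q' s]) auto
        then have "?J (Suc j) (q' @ [?w]) ?s \<and> reg ?s A = loc x + Suc j"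
          using s by (simp add: nth_append)
        then show "achieves (Block [Store ADR D, Store T W, Add T T ONE]) s 3
          (\<lambda>s. \<exists>q'. ?J (Suc j) q' s \<and> reg s A = loc x + Suc j)"
          by (intro achieves_Block) auto
      next
        assume "\<not> holds (Less Y ONE) s"
        then have "?w \<in> set q'"
          using s one by (auto split: if_splits)
        then have "bfs_state s0 u h (Suc j) q' s"
          using s 3(2) bfs_inv_old[of u h j q'] by (simp add: bfs_state_def)
        then show "achieves (Block []) s 3 (\<lambda>s. \<exists>q'. ?J (Suc j) q' s \<and> reg s A = loc x + Suc j)"
          using s by (intro achieves_Block) auto
      qed simp
    qed simp
  next
    case 4
    then show ?case by blast
  next
    case 5
    show ?case by simp
  qed
qed

lemma bfs_achieves:
  assumes "env s0" "u < n" "reg s0 ROW = row u" "reg s0 U = u"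
    and "\<And>w. w < n \<Longrightarrow> mem s0 (row u + w) = 0"
  shows "achieves bfs s0 (7 + 13 * n + 22 * card E)
    (\<lambda>s. (\<forall>r<15. reg s r = reg s0 r) \<and> rmem s = rmem s0 \<and>
       (\<forall>a. (a < free + n \<or> free + 2 * n \<le> a) \<and> (a < row u \<or> row u + n \<le> a) \<longrightarrow>
          mem s a = mem s0 a) \<and>
       (\<forall>w<n. mem s (row u + w) = Suc (dist u w)))"
    (is "achieves _ _ _ ?Q")
proof -
  \<comment> \<open>The potential charges each unfinished vertex for its round: 8 instructions of
    preparation, 2 steps to leave the inner loop, 1 increment, 2 steps of the outer loop, and 11 per
    neighbour. By the degree sum the total is \<open>13 * n + 22 * card E\<close>.\<close>
  define cost where "cost F = (\<Sum>w\<in>{..<n} - F. 13 + 11 * length (adj w))" for F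
  have "cost {} = 13 * n + 11 * (\<Sum>w<n. length (adj w))"
    by (simp add: cost_def sum.distrib sum_distrib_left)
  then have total: "cost {} = 13 * n + 22 * card E"
    by (simp add: sum_length_adj)
  have cost_insert: "cost F = 13 + 11 * length (adj x) + cost (insert x F)" if "x < n" "x \<notin> F" for x F
  proof -
    have "{..<n} - F - {x} = {..<n} - insert x F"
      by blast
    then show ?thesis
      using sum.remove[of "{..<n} - F" x "\<lambda>w. 13 + 11 * length (adj w)"] that by (simp add: cost_def)
  qed
  show ?thesis
    unfolding bfs_def
  proof (rule achieves_Seq)
    show "achieves (Block [Add ADR ROW U, Store ADR ONE, Store QUEUE U, Move H QUEUE, Add T QUEUE ONE])
      s0 5 (bfs_state s0 u 0 0 [u])"
      using assms row_bound[of u] gdist_self[of u "{..<n}" E] bfs_inv_start[OF assms(2)]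
      by (intro achieves_Block) (auto simp: env_def bfs_state_def)
  next
    fix s :: config
    assume s: "bfs_state s0 u 0 0 [u] s"
    show "achieves (While (Less H T)
        (Block [Load X H, Add ADR ROW X, Load D ADR, Add D D ONE, Add ADR OFFS X, Load A ADR,
           Load Z A, Add Z Z A] ;; scan_neighbours ;; Block [Add H H ONE])) s (cost {} + 2) ?Q"
    proof (rule achieves_While[where \<phi> = "cost {}" and
          I = "\<lambda>\<phi> s. \<exists>h q. bfs_state s0 u h 0 q s \<and> \<phi> = cost (set (take h q))"], goal_cases)
      case 1
      then show ?case
        using s by (intro exI[of _ 0] exI[of _ "[u]"]) simp
    next
      case (2 \<phi> s)
      then obtain h q where hq: "bfs_state s0 u h 0 q s" "\<phi> = cost (set (take h q))"
        by blast
      have h: "h < length q"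
        using hq(1) 2(2) by (simp add: bfs_state_def)
      define x where "x = q ! h"
      have inv: "bfs_inv u h 0 q"
        using hq(1) by (simp add: bfs_state_def)
      have x: "x < n" "x \<in> set q"
        using bfs_inv_nth[OF inv h] h by (simp_all add: x_def)
      \<comment> \<open>No vertex enters the queue twice, so \<open>x\<close> is not yet finished
        and its share of the potential is still available.\<close>
      have "distinct (take (Suc h) q)"
        using inv by (simp add: bfs_inv_def)
      then have xnew: "x \<notin> set (take h q)"
        using h by (simp add: take_Suc_conv_app_nth x_def)
      have regs: "reg s ONE = 1" "reg s ROW = row u" "reg s OFFS = free" "reg s H = free + n + h"
        using assms(1,3) hq(1) by (simp_all add: bfs_state_def env_def)
      have cells: "mem s (free + n + h) = x" "mem s (row u + x) = Suc (dist u x)"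
        using hq(1) h x by (simp_all add: bfs_state_def x_def)
      note graph = bfs_state_graph[OF assms(1) hq(1) x(1)]
      let ?T = "11 + 11 * length (adj x)"
      let ?P = "\<lambda>s'. \<exists>\<phi>'. (\<exists>h q. bfs_state s0 u h 0 q s' \<and> \<phi>' = cost (set (take h q))) \<and>
        \<phi>' + ?T + 2 \<le> \<phi>"
      have "achieves (Block [Load X H, Add ADR ROW X, Load D ADR, Add D D ONE, Add ADR OFFS X,
          Load A ADR, Load Z A, Add Z Z A] ;; scan_neighbours ;; Block [Add H H ONE]) s ?T ?P"
      proof (rule achieves_Seq)
        show "achieves (Block [Load X H, Add ADR ROW X, Load D ADR, Add D D ONE, Add ADR OFFS X,
            Load A ADR, Load Z A, Add Z Z A]) s 8
          (\<lambda>s. bfs_state s0 u h 0 q s \<and> reg s A = loc x \<and> reg s Z = loc x + length (adj x) \<and>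
             reg s D = Suc (Suc (dist u x)))"
          using hq(1) regs cells graph(1,2) by (intro achieves_Block) (simp_all add: bfs_state_def)
      next
        fix s :: config
        assume s: "bfs_state s0 u h 0 q s \<and> reg s A = loc x \<and> reg s Z = loc x + length (adj x) \<and>
             reg s D = Suc (Suc (dist u x))"
        show "achieves (scan_neighbours ;; Block [Add H H ONE]) s (11 * length (adj x) + 2 + 1) ?P"
        proof (rule achieves_Seq[OF scan_neighbours_achieves[OF assms(1-3) _ h x_def]])
          fix s :: config
          assume "\<exists>q'. bfs_state s0 u h (length (adj x)) q' s \<and> h < length q' \<and> q' ! h = x \<and>
            take h q' = take h q"
          then obtain q' where q': "bfs_state s0 u h (length (adj x)) q' s" "h < length q'"
            "q' ! h = x" "take h q' = take h q"
            by blast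
          let ?s = "fold exec [Add H H ONE] s"
          have "reg s ONE = 1"
            using assms(1) q'(1) by (simp add: bfs_state_def env_def)
          then have "bfs_state s0 u (Suc h) 0 q' ?s"
            using q' bfs_inv_next[of u h q'] by (simp add: bfs_state_def)
          moreover have "set (take (Suc h) q') = insert x (set (take h q))"
            using q' by (simp add: take_Suc_conv_app_nth)
          moreover have "cost (insert x (set (take h q))) + ?T + 2 \<le> \<phi>"
            using cost_insert[OF x(1) xnew] hq(2) by simp
          ultimately have "?P ?s"
            by metis
          then show "achieves (Block [Add H H ONE]) s 1 ?P"
            by (intro achieves_Block) auto
        qed (use s in simp_all)
      qed simp
      then show ?case
        by blast
    next
      case (3 \<phi> s)
      then obtain h q where hq: "bfs_state s0 u h 0 q s"
        by blast
      then have "bfs_inv u h 0 q" "\<not> h < length q"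
        using 3(2) by (simp_all add: bfs_state_def)
      then have "set q = {..<n}"
        using bfs_inv_end assms(2) by blast
      then show ?case
        using hq by (simp add: bfs_state_def)
    qed simp
  qed (use total in simp)
qed

section \<open>Territories and loads on the machine\<close>

lemma find_nearest_achieves:
  assumes "env s0" "u < n" "reg s0 ROW = row u" "reg s0 U = u"
    and "\<And>w. w < n \<Longrightarrow> mem s0 (row u + w) = Suc (dist u w)"
  shows "achieves find_nearest s0 (9 + 11 * p)
    (\<lambda>s. (\<forall>r<15. reg s r = reg s0 r) \<and> rmem s = rmem s0 \<and>
       (\<exists>d k. nearest u p d k \<and>
          mem s = (mem s0)(free + 2 * n + u := d, free + 3 * n + u := k)))"
    (is "achieves _ _ _ ?Q")
proof -
  let ?J = "\<lambda>s. (\<forall>r<15. reg s r = reg s0 r) \<and> rmem s = rmem s0 \<and> mem s = mem s0"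
  let ?I = "\<lambda>i s. ?J s \<and> reg s I = i \<and> nearest u i (reg s D) (reg s K)"
  have regs: "reg s0 NUM = n" "reg s0 LEN = p" "reg s0 ONE = 1" "reg s0 TWO = 2"
    "reg s0 RADIUS = free + 2 * n" "reg s0 NEAR = free + 3 * n"
    using assms(1) by (simp_all add: env_def)
  have S: "mem s0 (2 + i) = S ! i" if "i < p" for i
    using assms(1) that by (simp add: env_def graph_in_def)
  show ?thesis
    unfolding find_nearest_def
  proof (rule achieves_Seq)
    show "achieves (Block [Add D NUM ONE, Const K 0, Const I 0]) s0 3 (?I 0)"
      using regs nearest_0 by (intro achieves_Block) simp_all
  next
    fix s :: config
    assume s: "?I 0 s"
    show "achieves (While (Less I LEN)
        (Block [Add ADR TWO I, Load W ADR, Add ADR ROW W, Load Y ADR] ;;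
         Cond (Less Y D) (Block [Move D Y, Move K I]) (Block []) ;; Block [Add I I ONE]) ;;
      Block [Add ADR RADIUS U, Store ADR D, Add ADR NEAR U, Store ADR K]) s
      ((p * (9 + 2) + 2) + 4) ?Q"
    proof (rule achieves_Seq)
      show "achieves (While (Less I LEN)
        (Block [Add ADR TWO I, Load W ADR, Add ADR ROW W, Load Y ADR] ;;
         Cond (Less Y D) (Block [Move D Y, Move K I]) (Block []) ;; Block [Add I I ONE])) s
        (p * (9 + 2) + 2) (?I p)"
      proof (rule achieves_counting_While[where N = p and T = 9 and I = ?I], goal_cases)
        case (3 i s)
        have y: "mem s0 (row u + S ! i) = Suc (dist u (S ! i))"
          using assms(5) S_less[OF 3(2)] .
        note step = nearest_Suc[OF _ 3(2) assms(2)]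
        show ?case
        proof (rule achieves_Seq)
          show "achieves (Block [Add ADR TWO I, Load W ADR, Add ADR ROW W, Load Y ADR]) s 4
            (\<lambda>s. ?I i s \<and> reg s Y = Suc (dist u (S ! i)))"
            using 3 regs S[OF 3(2)] y assms(3) by (intro achieves_Block) simp_all
        next
          fix s :: config
          assume s: "?I i s \<and> reg s Y = Suc (dist u (S ! i))"
          show "achieves (Cond (Less Y D) (Block [Move D Y, Move K I]) (Block []) ;;
            Block [Add I I ONE]) s (4 + 1) (?I (Suc i))"
          proof (rule achieves_Seq)
            show "achieves (Cond (Less Y D) (Block [Move D Y, Move K I]) (Block [])) s 4
              (\<lambda>s. ?J s \<and> reg s I = i \<and> nearest u (Suc i) (reg s D) (reg s K))"
              by (rule achieves_Cond[where T = 2]; (intro achieves_Block)?)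
                (use s step[of "reg s D" "reg s K"] in simp_all)
          next
            fix s :: config
            assume "?J s \<and> reg s I = i \<and> nearest u (Suc i) (reg s D) (reg s K)"
            then show "achieves (Block [Add I I ONE]) s 1 (?I (Suc i))"
              using regs by (intro achieves_Block) simp_all
          qed simp
        qed simp
      qed (use s regs in simp_all)
    next
      fix s :: config
      assume "?I p s"
      then show "achieves (Block [Add ADR RADIUS U, Store ADR D, Add ADR NEAR U, Store ADR K]) s 4 ?Q"
        using regs assms(4) by (intro achieves_Block) auto
    qed simp
  qed simp
qed

definition rows_built :: "nat \<Rightarrow> config \<Rightarrow> bool" where
  "rows_built v s \<longleftrightarrow>
     (\<forall>u<v. (\<forall>w<n. mem s (row u + w) = Suc (dist u w)) \<and>
        nearest u p (mem s (free + 2 * n + u)) (mem s (free + 3 * n + u)))"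

lemma build_tables_achieves:
  assumes "env s0" "\<And>a. a \<ge> free + n \<Longrightarrow> mem s0 a = 0"
  shows "achieves build_tables s0 (4 + n * (20 + 13 * n + 22 * card E + 11 * p))
    (\<lambda>s. env s \<and> rows_built n s)"
proof -
  let ?J = "\<lambda>u s. env s \<and> rows_built u s \<and> reg s ROW = row u \<and> reg s U = u"
  \<comment> \<open>All cells from the current row on are still 0, as the next search requires of
    its row.\<close>
  let ?I = "\<lambda>u s. ?J u s \<and> (\<forall>a\<ge>row u. mem s a = 0)"
  show ?thesis
    unfolding build_tables_def
  proof (rule achieves_Seq)
    show "achieves (Block [Const U 0, Move ROW ROWS]) s0 2 (?I 0)"
      using assms by (intro achieves_Block) (simp_all add: env_def rows_built_def row_def)
  next
    fix s :: config
    assume s: "?I 0 s"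
    let ?T1 = "7 + 13 * n + 22 * card E"
    let ?T2 = "9 + 11 * p"
    show "achieves (While (Less U NUM) (bfs ;; find_nearest ;; Block [Add ROW ROW NUM, Add U U ONE])) s
      (n * ((?T1 + (?T2 + 2)) + 2) + 2) (\<lambda>s. env s \<and> rows_built n s)"
    proof (rule achieves_counting_While[where N = n and T = "?T1 + (?T2 + 2)" and I = ?I], goal_cases)
      case 1
      then show ?case
        using s by simp
    next
      case (3 u s0)
      then have s0: "env s0" "reg s0 ROW = row u" "reg s0 U = u" "u < n" "rows_built u s0"
        and zero: "\<And>a. row u \<le> a \<Longrightarrow> mem s0 a = 0"
        by simp_all
      show ?case
      proof (rule achieves_Seq[OF bfs_achieves[OF s0(1,4,2,3)]])
        fix s1 :: config
        assume bfs: "(\<forall>r<15. reg s1 r = reg s0 r) \<and> rmem s1 = rmem s0 \<and>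
          (\<forall>a. (a < free + n \<or> free + 2 * n \<le> a) \<and> (a < row u \<or> row u + n \<le> a) \<longrightarrow>
             mem s1 a = mem s0 a) \<and>
          (\<forall>w<n. mem s1 (row u + w) = Suc (dist u w))"
        have graph1: "graph_in (mem s1)"
          using s0(1) bfs row_bound[of u]
          by (intro graph_in_cong[of "mem s0" "mem s1"]) (simp_all add: env_def)
        have s1: "env s1" "reg s1 ROW = row u" "reg s1 U = u"
          using s0(1-3) bfs row_bound[of u] graph1 by (simp_all add: env_def)
        show "achieves (find_nearest ;; Block [Add ROW ROW NUM, Add U U ONE]) s1 (?T2 + 2) (?I (Suc u))"
        proof (rule achieves_Seq[OF find_nearest_achieves[OF s1(1) s0(4) s1(2,3)]])
          fix s2 :: config
          assume near: "(\<forall>r<15. reg s2 r = reg s1 r) \<and> rmem s2 = rmem s1 \<and>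
            (\<exists>d k. nearest u p d k \<and>
              mem s2 = (mem s1)(free + 2 * n + u := d, free + 3 * n + u := k))"
          \<comment> \<open>Both subroutines together touch only the queue, row \<open>u\<close> and
            the two entries of \<open>u\<close>, so what was built for smaller vertices
            persists.\<close>
          have frame: "mem s2 a = mem s0 a"
            if "(a < free + n \<or> free + 2 * n \<le> a) \<and> (a < row u \<or> row u + n \<le> a)"
              "a \<noteq> free + 2 * n + u" "a \<noteq> free + 3 * n + u" for a
            using near bfs that by auto
          have rowu: "mem s2 (row u + w) = Suc (dist u w)" if "w < n" for w
            using near bfs that row_bound[of u] s0(4) by auto
          have graph2: "graph_in (mem s2)"
            using s0(1) frame row_bound[of u]
            by (intro graph_in_cong[of "mem s0" "mem s2"]) (simp_all add: env_def)
          have env2: "env s2"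
            using s1(1) near graph2 frame row_bound[of u] s0(1,4) by (simp add: env_def)
          have "rows_built (Suc u) s2"
            unfolding rows_built_def
          proof (intro allI impI)
            fix v assume v: "v < Suc u"
            show "(\<forall>w<n. mem s2 (row v + w) = Suc (dist v w)) \<and>
              nearest v p (mem s2 (free + 2 * n + v)) (mem s2 (free + 3 * n + v))"
            proof (cases "v = u")
              case True
              then show ?thesis
                using rowu near s0(4) by auto
            next
              case False
              then have "v < u"
                using v by simp
              then have "mem s2 (row v + w) = mem s0 (row v + w)" if "w < n" for w
                using that row_mono[of v u] row_bound[of v] s0(4) by (intro frame) auto
              moreover have "mem s2 (free + 2 * n + v) = mem s0 (free + 2 * n + v)"
                "mem s2 (free + 3 * n + v) = mem s0 (free + 3 * n + v)"
                using \<open>v < u\<close> row_bound[of u] s0(4) by (auto intro!: frame)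
              ultimately show ?thesis
                using s0(5) \<open>v < u\<close> by (simp add: rows_built_def)
            qed
          qed
          moreover have "mem s2 a = 0" if "row (Suc u) \<le> a" for a
            using that frame[of a] zero[of a] row_bound[of u] s0(4) by (simp add: row_Suc)
          moreover have "reg s2 ROW = row u" "reg s2 U = u"
            using near s1 by simp_all
          ultimately show "achieves (Block [Add ROW ROW NUM, Add U U ONE]) s2 2 (?I (Suc u))"
            using env2 by (intro achieves_Block) (simp_all add: env_def rows_built_def row_Suc)
        qed (use bfs in simp_all)
      qed (use zero in simp_all)
    qed (simp_all add: env_def)
  qed (simp add: algebra_simps)
qed

definition tables :: "config \<Rightarrow> bool" where
  "tables s \<longleftrightarrow> env s \<and> rows_built n s"

section \<open>Loads of one candidate and their maximum\<close>

lemma clear_loads_achieves: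
  assumes "env s0"
  shows "achieves clear_loads s0 (4 + 5 * Suc p)
    (\<lambda>s. (\<forall>r<15. reg s r = reg s0 r) \<and> rreg s BEST = rreg s0 BEST \<and> mem s = mem s0 \<and>
       (\<forall>v<n. rmem s v = \<pi> v) \<and> (\<forall>i<Suc p. rmem s (n + i) = 0))"
proof -
  let ?I = "\<lambda>i s. (\<forall>r<15. reg s r = reg s0 r) \<and> rreg s BEST = rreg s0 BEST \<and> mem s = mem s0 \<and>
    (\<forall>v<n. rmem s v = \<pi> v) \<and> (\<forall>j<i. rmem s (n + j) = 0) \<and> reg s I = i \<and> rreg s TMP = 0"
  have regs: "reg s0 NUM = n" "reg s0 LEN1 = Suc p" "reg s0 ONE = 1" "\<forall>v<n. rmem s0 v = \<pi> v"
    using assms by (simp_all add: env_def)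
  show ?thesis
    unfolding clear_loads_def
  proof (rule achieves_Seq)
    show "achieves (Block [RZero TMP, Const I 0]) s0 2 (?I 0)"
      using regs by (intro achieves_Block) simp_all
  next
    fix s :: config
    assume s: "?I 0 s"
    show "achieves (While (Less I LEN1) (Block [Add ADR NUM I, RStore ADR TMP, Add I I ONE])) s
      (Suc p * (3 + 2) + 2) (\<lambda>s. (\<forall>r<15. reg s r = reg s0 r) \<and> rreg s BEST = rreg s0 BEST \<and>
        mem s = mem s0 \<and> (\<forall>v<n. rmem s v = \<pi> v) \<and> (\<forall>i<Suc p. rmem s (n + i) = 0))"
    proof (rule achieves_counting_While[where N = "Suc p" and T = 3 and I = ?I], goal_cases)
      case (3 i s)
      then show ?case
        using regs by (intro achieves_Block) (simp_all add: less_Suc_eq all_conj_distrib)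
    qed (use s regs in simp_all)
  qed simp
qed

lemma add_loads_achieves:
  assumes "tables s0" "reg s0 U = v" "v < n"
    and "\<forall>i<Suc p. rmem s0 (n + i) = 0"
  shows "achieves add_loads s0 (4 + 16 * n)
    (\<lambda>s. (\<forall>r<15. reg s r = reg s0 r) \<and> rreg s BEST = rreg s0 BEST \<and> mem s = mem s0 \<and>
       (\<forall>v<n. rmem s v = \<pi> v) \<and>
       (\<forall>i<Suc p. rmem s (n + i) = territory_load {..<n} E \<pi> (S @ [v]) i))" (is "achieves _ _ _ ?Q")
proof -
  let ?D = "\<lambda>u. mem s0 (free + 2 * n + u)"
  let ?K = "\<lambda>u. mem s0 (free + 3 * n + u)"
  let ?own = "\<lambda>u. owner v u (?D u) (?K u)"
  \<comment> \<open>The load cells hold the partial sums over \<open>{..<u}\<close> of the formula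
    in \<open>territory_load_owner\<close>. Adding \<open>n\<close> moves \<open>A\<close> from
    \<open>row u + v\<close> to \<open>row (Suc u) + v\<close>.\<close>
  let ?J = "\<lambda>u s. (\<forall>r<15. reg s r = reg s0 r) \<and> rreg s BEST = rreg s0 BEST \<and> mem s = mem s0 \<and>
    (\<forall>v<n. rmem s v = \<pi> v) \<and>
    (\<forall>i<Suc p. rmem s (n + i) = (\<Sum>w<u. if ?own w = i then \<pi> w else 0)) \<and>
    reg s X = u \<and> reg s A = row u + v"
  have regs: "reg s0 NUM = n" "reg s0 LEN = p" "reg s0 ONE = 1" "reg s0 ROWS = free + 4 * n"
    "reg s0 RADIUS = free + 2 * n" "reg s0 NEAR = free + 3 * n" "\<forall>v<n. rmem s0 v = \<pi> v"
    using assms(1) by (simp_all add: tables_def env_def)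
  have near: "nearest u p (?D u) (?K u)" if "u < n" for u
    using assms(1) that by (simp add: tables_def rows_built_def)
  show ?thesis
    unfolding add_loads_def
  proof (rule achieves_Seq)
    show "achieves (Block [Const X 0, Add A ROWS U]) s0 2 (?J 0)"
      using regs assms(2,4) by (intro achieves_Block) (simp_all add: row_def)
  next
    fix s :: config
    assume s: "?J 0 s"
    show "achieves (While (Less X NUM)
       (Block [Load Y A, Add ADR RADIUS X, Load D ADR] ;;
        Cond (Less Y D) (Block [Move K LEN]) (Block [Add ADR NEAR X, Load K ADR]) ;;
        Block [Add ADR NUM K, RLoad TMP ADR, RLoad CUR X, RAdd TMP TMP CUR, RStore ADR TMP,
               Add A A NUM, Add X X ONE])) s (n * (14 + 2) + 2) ?Q"
    proof (rule achieves_counting_While[where N = n and T = 14 and I = ?J], goal_cases)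
      case (3 u s)
      have y: "mem s0 (row u + v) = Suc (dist u v)"
        using assms(1,3) 3(2) by (simp add: tables_def rows_built_def)
      show ?case
      proof (rule achieves_Seq)
        show "achieves (Block [Load Y A, Add ADR RADIUS X, Load D ADR]) s 3
          (\<lambda>s. ?J u s \<and> reg s Y = Suc (dist u v) \<and> reg s D = ?D u)"
          using 3 regs y by (intro achieves_Block) simp_all
      next
        fix s :: config
        assume s: "?J u s \<and> reg s Y = Suc (dist u v) \<and> reg s D = ?D u"
        show "achieves (Cond (Less Y D) (Block [Move K LEN]) (Block [Add ADR NEAR X, Load K ADR]) ;;
            Block [Add ADR NUM K, RLoad TMP ADR, RLoad CUR X, RAdd TMP TMP CUR, RStore ADR TMP,
               Add A A NUM, Add X X ONE]) s (4 + 7) (?J (Suc u))"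
        proof (rule achieves_Seq)
          show "achieves (Cond (Less Y D) (Block [Move K LEN]) (Block [Add ADR NEAR X, Load K ADR])) s 4
            (\<lambda>s. ?J u s \<and> reg s K = ?own u)"
            by (rule achieves_Cond[where T = 2]; (intro achieves_Block)?)
              (use s regs in \<open>simp_all add: owner_def\<close>)
        next
          fix s :: config
          assume s: "?J u s \<and> reg s K = ?own u"
          then show "achieves (Block [Add ADR NUM K, RLoad TMP ADR, RLoad CUR X, RAdd TMP TMP CUR,
              RStore ADR TMP, Add A A NUM, Add X X ONE]) s 7 (?J (Suc u))"
            using regs 3(2) owner_less[OF near[OF 3(2)] 3(2) assms(3)]
            by (intro achieves_Block) (simp_all add: row_Suc)
        qed simp
      qed simp
    qed (use s regs in \<open>simp_all add: territory_load_owner[OF near assms(3)]\<close>)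
  qed simp
qed

lemma find_max_achieves:
  assumes "tables s0" "v < n"
    and "\<forall>i<Suc p. rmem s0 (n + i) = territory_load {..<n} E \<pi> (S @ [v]) i"
  shows "achieves find_max s0 (4 + 8 * Suc p)
    (\<lambda>s. (\<forall>r<15. reg s r = reg s0 r) \<and> rreg s BEST = rreg s0 BEST \<and> mem s = mem s0 \<and>
       rmem s = rmem s0 \<and> rreg s CUR = max_load {..<n} E \<pi> (S @ [v]))" (is "achieves _ _ _ ?Q")
proof -
  let ?load = "territory_load {..<n} E \<pi> (S @ [v])"
  let ?J = "\<lambda>s. (\<forall>r<15. reg s r = reg s0 r) \<and> rreg s BEST = rreg s0 BEST \<and> mem s = mem s0 \<and>
    rmem s = rmem s0"
  \<comment> \<open>Inserting 0 gives the empty prefix a maximum, the initial value of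
    \<open>CUR\<close>; \<open>max_load_eq\<close> removes it again at the end.\<close>
  define peak where "peak i = Max (insert 0 (?load ` {..<i}))" for i
  let ?I = "\<lambda>i s. ?J s \<and> reg s I = i \<and> rreg s CUR = peak i"
  have regs: "reg s0 NUM = n" "reg s0 LEN1 = Suc p" "reg s0 ONE = 1"
    using assms(1) by (simp_all add: tables_def env_def)
  have peak: "peak 0 = 0" "peak (Suc i) = max (?load i) (peak i)" for i
    by (simp_all add: peak_def lessThan_Suc insert_commute[of 0])
  have final: "peak (Suc p) = max_load {..<n} E \<pi> (S @ [v])"
    using max_load_eq[OF assms(2)] by (simp add: peak_def)
  show ?thesis
    unfolding find_max_def
  proof (rule achieves_Seq)
    show "achieves (Block [RZero CUR, Const I 0]) s0 2 (?I 0)"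
      using regs peak(1) by (intro achieves_Block) simp_all
  next
    fix s :: config
    assume s: "?I 0 s"
    show "achieves (While (Less I LEN1)
       (Block [Add ADR NUM I, RLoad TMP ADR] ;;
        Cond (RLess CUR TMP) (Block [RMove CUR TMP]) (Block []) ;;
        Block [Add I I ONE])) s (Suc p * (6 + 2) + 2) ?Q"
    proof (rule achieves_counting_While[where N = "Suc p" and T = 6 and I = ?I], goal_cases)
      case (3 i s)
      show ?case
      proof (rule achieves_Seq)
        show "achieves (Block [Add ADR NUM I, RLoad TMP ADR]) s 2 (\<lambda>s. ?I i s \<and> rreg s TMP = ?load i)"
          using 3 regs assms(3) by (intro achieves_Block) simp_all
      next
        fix s :: config
        assume s: "?I i s \<and> rreg s TMP = ?load i"
        show "achieves (Cond (RLess CUR TMP) (Block [RMove CUR TMP]) (Block []) ;; Block [Add I I ONE])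
          s (3 + 1) (?I (Suc i))"
        proof (rule achieves_Seq)
          show "achieves (Cond (RLess CUR TMP) (Block [RMove CUR TMP]) (Block [])) s 3
            (\<lambda>s. ?J s \<and> reg s I = i \<and> rreg s CUR = peak (Suc i))"
            by (rule achieves_Cond[where T = 1]; (intro achieves_Block)?)
              (use s in \<open>simp_all add: peak(2)\<close>)
        next
          fix s :: config
          assume "?J s \<and> reg s I = i \<and> rreg s CUR = peak (Suc i)"
          then show "achieves (Block [Add I I ONE]) s 1 (?I (Suc i))"
            using regs by (intro achieves_Block) simp_all
        qed simp
      qed simp
    qed (use s regs final in simp_all)
  qed simp
qed

section \<open>Search for the best candidate\<close>

definition best_so_far :: "nat \<Rightarrow> config \<Rightarrow> bool" where
  "best_so_far v s \<longleftrightarrow>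
     (if reg s FOUND < 1 then {..<v} \<subseteq> set S
      else reg s OUT \<in> {..<n} - set S \<and>
        rreg s BEST = max_load {..<n} E \<pi> (S @ [reg s OUT]) \<and>
        (\<forall>w\<in>{..<v} - set S. rreg s BEST \<le> max_load {..<n} E \<pi> (S @ [w])))"

text \<open>\<open>env\<close> speaks only of registers 2 to 11, so the tables survive changes of
  \<open>OUT\<close>, \<open>FOUND\<close> and the loop counter \<open>U\<close>.\<close>

lemma tables_cong:
  assumes "tables s" "\<And>r. r < 12 \<Longrightarrow> r \<noteq> OUT \<Longrightarrow> reg s' r = reg s r" "mem s' = mem s"
    and "\<forall>v<n. rmem s' v = \<pi> v"
  shows "tables s'"
  using assms by (simp add: tables_def env_def rows_built_def)

lemma evaluate_candidate:
  assumes "tables s0" "reg s0 U = v" "v < n" "v \<notin> set S" "best_so_far v s0"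
  shows "achieves (clear_loads ;; add_loads ;; find_max ;;
      Cond (Less FOUND ONE) record_best (Cond (RLess CUR BEST) record_best (Block []))) s0
    (32 + 13 * p + 16 * n) (\<lambda>s. tables s \<and> reg s U = v \<and> best_so_far (Suc v) s)"
    (is "achieves _ _ _ ?Q")
proof (rule achieves_Seq[OF clear_loads_achieves])
  show "env s0"
    using assms(1) by (simp add: tables_def)
next
  let ?T3 = "4 + 8 * Suc p + 7"
  let ?load = "territory_load {..<n} E \<pi> (S @ [v])"
  \<comment> \<open>The three subroutines respect all registers below 15 and \<open>BEST\<close>, so
    only \<open>record_best\<close> can affect the invariant.\<close>
  have carry: "tables s' \<and> reg s' U = v \<and> best_so_far v s'"
    if "tables s \<and> reg s U = v \<and> best_so_far v s" "\<forall>r<15. reg s' r = reg s r"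
      "rreg s' BEST = rreg s BEST" "mem s' = mem s" "\<forall>v<n. rmem s' v = \<pi> v" for s s'
  proof -
    have "best_so_far v s' \<longleftrightarrow> best_so_far v s"
      using that by (simp add: best_so_far_def)
    then show ?thesis
      using that tables_cong[of s s'] by simp
  qed
  fix s1 :: config
  assume s1: "(\<forall>r<15. reg s1 r = reg s0 r) \<and> rreg s1 BEST = rreg s0 BEST \<and> mem s1 = mem s0 \<and>
       (\<forall>v<n. rmem s1 v = \<pi> v) \<and> (\<forall>i<Suc p. rmem s1 (n + i) = 0)"
  then have c1: "tables s1 \<and> reg s1 U = v \<and> best_so_far v s1"
    using assms carry[of s0 s1] by blast
  show "achieves (add_loads ;; find_max ;;
      Cond (Less FOUND ONE) record_best (Cond (RLess CUR BEST) record_best (Block []))) s1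
    ((4 + 16 * n) + ?T3) ?Q"
  proof (rule achieves_Seq[OF add_loads_achieves[where v = v]])
    fix s2 :: config
    assume s2: "(\<forall>r<15. reg s2 r = reg s1 r) \<and> rreg s2 BEST = rreg s1 BEST \<and> mem s2 = mem s1 \<and>
       (\<forall>v<n. rmem s2 v = \<pi> v) \<and> (\<forall>i<Suc p. rmem s2 (n + i) = ?load i)"
    then have c2: "tables s2 \<and> reg s2 U = v \<and> best_so_far v s2"
      using c1 carry[of s1 s2] by blast
    show "achieves (find_max ;;
      Cond (Less FOUND ONE) record_best (Cond (RLess CUR BEST) record_best (Block []))) s2 ?T3 ?Q"
    proof (rule achieves_Seq[OF find_max_achieves[where v = v]])
      fix s3 :: config
      assume s3: "(\<forall>r<15. reg s3 r = reg s2 r) \<and> rreg s3 BEST = rreg s2 BEST \<and> mem s3 = mem s2 \<and>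
        rmem s3 = rmem s2 \<and> rreg s3 CUR = max_load {..<n} E \<pi> (S @ [v])"
      then have c3: "tables s3" "reg s3 U = v" "best_so_far v s3"
        using c2 s2 carry[of s2 s3] by simp_all
      have one: "reg s3 ONE = 1" and pi: "\<forall>v<n. rmem s3 v = \<pi> v"
        using c3(1) by (simp_all add: tables_def env_def)
      \<comment> \<open>Both occasions for recording reduce to this condition: it is vacuous for the
        first candidate, and follows by transitivity when the old optimum is beaten.\<close>
      have update: "achieves record_best s3 3 ?Q"
        if "\<forall>w\<in>{..<v} - set S. rreg s3 CUR \<le> max_load {..<n} E \<pi> (S @ [w])"
        unfolding record_best_def using that c3 s3 assms(3,4) pi
        by (intro achieves_Block)
          (auto simp: best_so_far_def less_Suc_eq intro: tables_cong[OF c3(1)])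
      show "achieves (Cond (Less FOUND ONE) record_best
          (Cond (RLess CUR BEST) record_best (Block []))) s3 7 ?Q"
      proof (rule achieves_Cond)
        assume "holds (Less FOUND ONE) s3"
        then have "{..<v} \<subseteq> set S"
          using c3(3) one by (simp add: best_so_far_def)
        then show "achieves record_best s3 5 ?Q"
          by (intro achieves_weaken[OF update]) auto
      next
        assume found: "\<not> holds (Less FOUND ONE) s3"
        show "achieves (Cond (RLess CUR BEST) record_best (Block [])) s3 5 ?Q"
        proof (rule achieves_Cond)
          assume "holds (RLess CUR BEST) s3"
          moreover have "\<forall>w\<in>{..<v} - set S. rreg s3 BEST \<le> max_load {..<n} E \<pi> (S @ [w])"
            using found c3(3) one by (auto simp: best_so_far_def)
          ultimately show "achieves record_best s3 3 ?Q"
            by (intro update) force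
        next
          assume "\<not> holds (RLess CUR BEST) s3"
          then have "best_so_far (Suc v) s3"
            using found c3(3) one s3 by (auto simp: best_so_far_def less_Suc_eq)
          then show "achieves (Block []) s3 3 ?Q"
            using c3 by (intro achieves_Block) simp_all
        qed simp
      qed simp
    qed (use c2 s2 assms(3) in simp_all)
  qed (use c1 s1 assms(3) in simp_all)
qed simp

lemma search_achieves:
  assumes "tables s0"
  shows "achieves search s0 (4 + n * (39 + 13 * p + 16 * n))
    (\<lambda>s. balanced_vertex_solution {..<n} E \<pi> S (reg s OUT))"
proof -
  let ?I = "\<lambda>v s. tables s \<and> reg s U = v \<and> best_so_far v s"
  let ?T = "32 + 13 * p + 16 * n"
  show ?thesis
    unfolding search_def
  proof (rule achieves_Seq)
    show "achieves (Block [Const U 0, Const FOUND 0]) s0 2 (?I 0)"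
    proof (intro achieves_Block)
      let ?s = "fold exec [Const U 0, Const FOUND 0] s0"
      have "\<forall>v<n. rmem s0 v = \<pi> v" "reg s0 ONE = 1"
        using assms by (simp_all add: tables_def env_def)
      then have "tables ?s"
        by (intro tables_cong[OF assms]) simp_all
      then show "?I 0 ?s"
        by (simp add: best_so_far_def)
    qed simp_all
  next
    fix s :: config
    assume s: "?I 0 s"
    show "achieves (While (Less U NUM)
       (Block [Add ADR RADIUS U, Load D ADR] ;;
        Cond (Less ONE D)
          (clear_loads ;; add_loads ;; find_max ;;
           Cond (Less FOUND ONE) record_best (Cond (RLess CUR BEST) record_best (Block [])))
          (Block []) ;;
        Block [Add U U ONE])) s (n * ((?T + 5) + 2) + 2)
      (\<lambda>s. balanced_vertex_solution {..<n} E \<pi> S (reg s OUT))"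
    proof (rule achieves_counting_While[where N = n and T = "?T + 5" and I = ?I], goal_cases)
      case 1
      then show ?case
        using s by simp
    next
      case (2 v s)
      then show ?case
        by (simp add: tables_def env_def)
    next
      case (3 v s)
      let ?d = "mem s (free + 2 * n + v)"
      have near: "nearest v p ?d (mem s (free + 3 * n + v))"
        using 3 by (simp add: tables_def rows_built_def)
      show ?case
      proof (rule achieves_Seq)
        show "achieves (Block [Add ADR RADIUS U, Load D ADR]) s 2 (\<lambda>s. ?I v s \<and> reg s D = ?d)"
          using 3 by (intro achieves_Block)
            (auto simp: best_so_far_def tables_def env_def rows_built_def)
      next
        fix s' :: config
        assume s': "?I v s' \<and> reg s' D = ?d"
        show "achieves (Cond (Less ONE D)
          (clear_loads ;; add_loads ;; find_max ;;
           Cond (Less FOUND ONE) record_best (Cond (RLess CUR BEST) record_best (Block [])))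
          (Block []) ;; Block [Add U U ONE]) s' ((?T + 2) + 1) (?I (Suc v))"
        proof (rule achieves_Seq)
          show "achieves (Cond (Less ONE D)
            (clear_loads ;; add_loads ;; find_max ;;
             Cond (Less FOUND ONE) record_best (Cond (RLess CUR BEST) record_best (Block [])))
            (Block [])) s' (?T + 2) (\<lambda>s. tables s \<and> reg s U = v \<and> best_so_far (Suc v) s)"
          proof (rule achieves_Cond)
            have iff: "holds (Less ONE D) s' \<longleftrightarrow> v \<notin> set S"
              using s' nearest_greater_1_iff[OF near 3(2)] by (simp add: tables_def env_def)
            {
              assume "holds (Less ONE D) s'"
              then show "achieves (clear_loads ;; add_loads ;; find_max ;;
               Cond (Less FOUND ONE) record_best (Cond (RLess CUR BEST) record_best (Block [])))
                s' ?T (\<lambda>s. tables s \<and> reg s U = v \<and> best_so_far (Suc v) s)"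
                using evaluate_candidate s' 3(2) iff by blast
            next
              assume "\<not> holds (Less ONE D) s'"
              then have "{..<Suc v} \<subseteq> set S \<longleftrightarrow> {..<v} \<subseteq> set S" "{..<Suc v} - set S = {..<v} - set S"
                using iff by (auto simp: lessThan_Suc)
              then have "best_so_far (Suc v) s' \<longleftrightarrow> best_so_far v s'"
                by (simp add: best_so_far_def)
              then show "achieves (Block []) s' ?T (\<lambda>s. tables s \<and> reg s U = v \<and> best_so_far (Suc v) s)"
                using s' by (intro achieves_Block) simp_all
            }
          qed simp
        next
          fix s :: config
          assume "tables s \<and> reg s U = v \<and> best_so_far (Suc v) s"
          then show "achieves (Block [Add U U ONE]) s 1 (?I (Suc v))"
            by (intro achieves_Block) (auto simp: best_so_far_def tables_def env_def rows_built_def)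
        qed simp
      qed simp
    next
      \<comment> \<open>Some vertex lies outside \<open>S\<close>, so after all \<open>n\<close>
        vertices a candidate has been recorded.\<close>
      case (4 s)
      then show ?case
        using nontrivial by (auto simp: best_so_far_def balanced_vertex_solution_def split: if_splits)
    qed simp
  qed (simp add: algebra_simps)
qed

section \<open>Total running time\<close>

lemma balanced_vertex_program_achieves:
  "achieves balanced_vertex_program (initial_config n adj \<pi> S)
     (26 + 14 * n + n * (20 + 13 * n + 22 * card E + 11 * p) + n * (39 + 13 * p + 16 * n))
     (\<lambda>s. balanced_vertex_solution {..<n} E \<pi> S (reg s OUT))"
  unfolding balanced_vertex_program_def
proof (rule achieves_Seq[OF prepare_achieves])
  fix s :: config
  assume s: "env s \<and> (\<forall>a\<ge>free + n. mem s a = 0)"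
  show "achieves (build_tables ;; search) s
    ((4 + n * (20 + 13 * n + 22 * card E + 11 * p)) + (4 + n * (39 + 13 * p + 16 * n)))
    (\<lambda>s. balanced_vertex_solution {..<n} E \<pi> S (reg s OUT))"
  proof (rule achieves_Seq[OF build_tables_achieves])
    fix s :: config
    assume "env s \<and> rows_built n s"
    then show "achieves search s (4 + n * (39 + 13 * p + 16 * n))
      (\<lambda>s. balanced_vertex_solution {..<n} E \<pi> S (reg s OUT))"
      by (intro search_achieves) (simp add: tables_def)
  qed (use s in simp_all)
qed simp

text \<open>Bounding \<open>n * n\<close> and \<open>n * p\<close> by
  \<open>2 * (n * card E)\<close>, and \<open>n\<close> and 1 by \<open>n * card E\<close>, turns
  the coefficients into \<open>26 + 73 + 2 * 29 + 22 + 2 * 24 = 227\<close>.\<close>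

lemma program_time_bound:
  assumes "card E > 0"
  shows "26 + 14 * n + n * (20 + 13 * n + 22 * card E + 11 * p) + n * (39 + 13 * p + 16 * n)
    \<le> 227 * (n * card E)"
proof -
  have "n \<le> 2 * card E"
    using card_vertices_le[OF simple connected] assms by (cases "E = {}") auto
  then have nn: "n * n \<le> 2 * (n * card E)"
    using mult_le_mono2[of n "2 * card E" n] by simp
  have np: "n * p \<le> n * n"
    using p_less_n by simp
  have n1: "n \<le> n * card E" "1 \<le> n * card E"
    using assms p_less_n by simp_all
  have "26 + 14 * n + n * (20 + 13 * n + 22 * card E + 11 * p) + n * (39 + 13 * p + 16 * n)
    = 26 + 73 * n + 29 * (n * n) + 22 * (n * card E) + 24 * (n * p)"
    by (simp add: algebra_simps)
  then show ?thesis
    using nn np n1 by linarith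
qed

end

theorem theorem2p5:
  "\<exists>(P :: program) (C :: nat).
     \<forall>(n :: nat) (E :: nat set set) (\<pi> :: nat \<Rightarrow> real) (S :: nat list) (adj :: nat \<Rightarrow> nat list).
       balanced_vertex_instance {..<n} E \<pi> S \<and> adjacency_lists n E adj \<longrightarrow>
       (\<exists>t c. halts_within P (initial_config n adj \<pi> S) t c \<and>
              balanced_vertex_solution {..<n} E \<pi> S (result_of c) \<and>
              (card E > 0 \<longrightarrow> t \<le> C * (n * card E)))"
proof (rule exI[of _ "compile 0 balanced_vertex_program"], rule exI[of _ 227], intro allI impI)
  fix n E \<pi> S adj
  assume "balanced_vertex_instance {..<n} E \<pi> S \<and> adjacency_lists n E adj"
  then interpret balanced_vertex_input n E \<pi> S adj
    by unfold_locales auto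
  have "pc (initial_config n adj \<pi> S) = 0"
    by (simp add: initial_config_def)
  from achieves_halts_within[OF balanced_vertex_program_achieves this]
  obtain t c where "halts_within (compile 0 balanced_vertex_program) (initial_config n adj \<pi> S) t c"
    "balanced_vertex_solution {..<n} E \<pi> S (reg c OUT)"
    "t \<le> 26 + 14 * n + n * (20 + 13 * n + 22 * card E + 11 * p) + n * (39 + 13 * p + 16 * n)"
    by auto
  then show "\<exists>t c. halts_within (compile 0 balanced_vertex_program) (initial_config n adj \<pi> S) t c \<and>
      balanced_vertex_solution {..<n} E \<pi> S (result_of c) \<and>
      (card E > 0 \<longrightarrow> t \<le> 227 * (n * card E))"
    using program_time_bound by (fastforce simp: result_of_def)
qed

end
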